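(* Let $P\subseteq\mathbb{R}^n$ be a rational polyhedron with vertices $\{v^i\}_{i\in V}$ and extreme rays $\{r^j\}_{j\in E}$, i.e. $P=\operatorname{conv}(\{v^i\}_{i\in V})+\operatorname{cone}(\{r^j\}_{j\in E})$, and let $w>0$. Let $\bar{\mathcal{L}}$ be any family of mixed integer split polyhedra in $\mathbb{R}^n$ that have max-facet-width at most $w$. Then the set $$\bigcap_{L\in\bar{\mathcal{L}}}R(L,P)$$ is a polyhedron.
   Context: $V,E$ are finite, $v^i\in\mathbb{Q}^n$, $r^j\in\mathbb{Z}^n$; $n=p+q$ with $p>0$, and the first $p$ coordinates are the integer constrained ones, $N_I=\{1,\dots,p\}$. A convex set $C\subseteq\mathbb{R}^p$ is lattice point free if $\operatorname{ri}(C)\cap\mathbb{Z}^p=\emptyset$, where $\operatorname{ri}$ is relative interior. A split polyhedron in $\mathbb{R}^p$ is a lattice point free rational polyhedron that is maximal with respect to inclusion (among lattice point free convex sets). Every split polyhedron is full dimensional and is the sum of a rational polytope and a linear space. A mixed integer split polyhedron is a set $L=\{(x,y)\in\mathbb{R}^p\times\mathbb{R}^q:x\in L^x\}$ with $L^x$ a split polyhedron in $\mathbb{R}^p$. Write $L=\{x\in\mathbb{R}^n:(\pi^k)^Tx\ge\pi^k_0,\ k\in N_f(L)\}$ with one inequality per facet, $(\pi^k,\pi^k_0)\in\mathbb{Z}^{n+1}$, $\pi^k_j=0$ for $j\notin N_I$, and such that $\pi_0^k$ and all the integers $\pi^k_j$, $j=1,\dots,p$, have no common divisor greater than 1 (this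 representation is unique). The width of $L$ along $\pi$ is $w(L,\pi)=\max\{\pi^Tx:x\in L\}-\min\{\pi^Tx:x\in L\}$, and the max-facet-width of $L$ is $w_f(L)=\max\{w(L,\pi^k):k\in N_f(L)\}$. $R(L,P):=\operatorname{conv}(\{x\in P:x\notin\operatorname{int}(L)\})$. *)

theory Defs
  imports "HOL-Analysis.Analysis"
begin

definition rational_polyhedron :: "(real^'n) set \<Rightarrow> bool" where
  "rational_polyhedron S \<longleftrightarrow>
     (\<exists>F. finite F \<and> (\<forall>(a, b)\<in>F. (\<forall>j. a $ j \<in> \<rat>) \<and> b \<in> \<rat>) \<and>
          S = {x. \<forall>(a, b)\<in>F. a \<bullet> x \<ge> b})"

definition recession_cone :: "(real^'n) set \<Rightarrow> (real^'n) set" where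
  "recession_cone P = {d. \<forall>x\<in>P. \<forall>t\<ge>0. x + t *\<^sub>R d \<in> P}"

definition extreme_ray_of :: "real^'n \<Rightarrow> (real^'n) set \<Rightarrow> bool" where
  "extreme_ray_of d P \<longleftrightarrow> d \<noteq> 0 \<and> {t *\<^sub>R d | t. 0 \<le> t} face_of recession_cone P"

definition lattice_point_free :: "(real^'p) set \<Rightarrow> bool" where
  "lattice_point_free C \<longleftrightarrow> rel_interior C \<inter> {x. \<forall>i. x $ i \<in> \<int>} = {}"

definition split_polyhedron :: "(real^'p) set \<Rightarrow> bool" where
  "split_polyhedron S \<longleftrightarrow>
     rational_polyhedron S \<and> lattice_point_free S \<and>
     (\<forall>C. convex C \<and> lattice_point_free C \<and> S \<subseteq> C \<longrightarrow> C = S)"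

text \<open>
  The coordinates of the ambient space are indexed by \<^typ>\<open>'n\<close>, and \<^term>\<open>\<iota> :: 'p \<Rightarrow> 'n\<close> is
  an injection whose range is the set \<open>N\<^sub>I\<close> of integer constrained coordinates.  Thus
  \<open>p = CARD('p) > 0\<close>, \<open>n = CARD('n)\<close>, and \<open>q = n - p\<close> may be \<open>0\<close>.
\<close>

definition mixed_integer_split :: "('p::finite \<Rightarrow> 'n::finite) \<Rightarrow> (real^'n) set \<Rightarrow> bool" where
  "mixed_integer_split \<iota> L \<longleftrightarrow>
     (\<exists>Lx :: (real^'p) set. split_polyhedron Lx \<and> L = {z. (\<chi> i. z $ \<iota> i) \<in> Lx})"

definition real_vec :: "int^'n \<Rightarrow> real^'n" where
  "real_vec \<pi> = (\<chi> j. of_int (\<pi> $ j))"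

text \<open>
  \<^term>\<open>N\<close> is the set of pairs \<open>(\<pi>\<^sup>k, \<pi>\<^sub>0\<^sup>k)\<close> of the normalized facet description of \<^term>\<open>L\<close>;
  the bijection expresses that there is exactly one inequality per facet.
\<close>

definition facet_representation ::
    "('p::finite \<Rightarrow> 'n::finite) \<Rightarrow> (real^'n) set \<Rightarrow> ((int^'n) \<times> int) set \<Rightarrow> bool" where
  "facet_representation \<iota> L N \<longleftrightarrow>
     L = {x. \<forall>(\<pi>, \<pi>0)\<in>N. real_vec \<pi> \<bullet> x \<ge> of_int \<pi>0} \<and>
     bij_betw (\<lambda>(\<pi>, \<pi>0). L \<inter> {x. real_vec \<pi> \<bullet> x = of_int \<pi>0}) N {F. F facet_of L} \<and>
     (\<forall>(\<pi>, \<pi>0)\<in>N. (\<forall>j. j \<notin> range \<iota> \<longrightarrow> \<pi> $ j = 0) \<and>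
                  Gcd (insert \<pi>0 (range (\<lambda>i. \<pi> $ \<iota> i))) = 1)"

text \<open>
  The width takes extended real values, so that it is \<open>\<infinity>\<close> for a nonempty set that is unbounded
  along \<^term>\<open>\<pi>\<close>.  On a nonempty polyhedron on which \<open>\<pi>\<close> is bounded, the supremum and the
  infimum are attained.
\<close>

definition width :: "(real^'n) set \<Rightarrow> real^'n \<Rightarrow> ereal" where
  "width L \<pi> = (SUP x\<in>L. ereal (\<pi> \<bullet> x)) - (INF x\<in>L. ereal (\<pi> \<bullet> x))"

text \<open>
  For a mixed integer split polyhedron the facet representation exists and is unique, and it is
  finite and nonempty.
\<close>

definition max_facet_width :: "('p::finite \<Rightarrow> 'n::finite) \<Rightarrow> (real^'n) set \<Rightarrow> ereal" where
  "max_facet_width \<iota> L =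
     Max ((\<lambda>(\<pi>, \<pi>0). width L (real_vec \<pi>)) ` (THE N. facet_representation \<iota> L N))"

definition R :: "(real^'n) set \<Rightarrow> (real^'n) set \<Rightarrow> (real^'n) set" where
  "R L P = convex hull {x \<in> P. x \<notin> interior L}"

end

theory Submission
  imports Defs
begin

text \<open>
  Let \<open>W\<close> be the vertices and \<open>T\<close> the rays of \<open>P\<close>. The recession directions of a split polyhedron
  are lineality directions, so \<open>R L P\<close> is the cone of \<open>T\<close> plus the convex hull of finitely
  many points: the vertices outside \<open>int L\<close>, and for each vertex \<open>v\<close> in \<open>int L\<close> the points where
  the segments to outer vertices and the rays in the directions \<open>T\<close> leave \<open>int L\<close>. Earlier exits,
  i.e. larger exit rates, give larger sets \<open>R L P\<close>. The exit rate of a facet is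
  \<open>- (\<pi> \<bullet> d) / (\<pi> \<bullet> v - \<pi>0)\<close>, where the denominator lies in \<open>(0, w]\<close> by the width bound and
  in \<open>(1/D)\<int>\<close> for a common denominator \<open>D\<close> of the vertices; hence all rates, over all members of the
  family, are nonnegative integer multiples of one positive number. By Dickson's lemma finitely many
  members have minimal rate vectors for each set of vertices in \<open>int L\<close>, and these already
  determine the intersection.
\<close>

section \<open>Removing an open polyhedron from a polyhedron\<close>

text \<open>By induction on the index set: a basis \<open>B0\<close> for the old coordinates also
  serves every element whose new coordinate is at least the maximum \<open>m\<close> of that
  coordinate over \<open>B0\<close>; each of the finitely many smaller values gets a basis of its
  own slice.\<close>

lemma dickson_finite_basis:
  fixes f :: "'a \<Rightarrow> 'k \<Rightarrow> nat"
  assumes "finite K"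
  shows "\<exists>B\<subseteq>A. finite B \<and> (\<forall>a\<in>A. \<exists>b\<in>B. \<forall>k\<in>K. f b k \<le> f a k)"
  using assms
proof (induction K arbitrary: A rule: finite_induct)
  case empty
  show ?case
  proof (cases "A = {}")
    case False
    then obtain a where "a \<in> A" by blast
    then show ?thesis by (intro exI[of _ "{a}"]) auto
  qed auto
next
  case (insert k K)
  obtain B0 where B0: "B0 \<subseteq> A" "finite B0" "\<forall>a\<in>A. \<exists>b\<in>B0. \<forall>k\<in>K. f b k \<le> f a k"
    using insert.IH[of A] by blast
  define good where "good c B \<longleftrightarrow> B \<subseteq> {a\<in>A. f a k = c} \<and> finite B \<and>
      (\<forall>a\<in>{a\<in>A. f a k = c}. \<exists>b\<in>B. \<forall>k\<in>K. f b k \<le> f a k)" for c B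
  have "\<exists>B. good c B" for c
    unfolding good_def by (rule insert.IH)
  then obtain C where "\<And>c. good c (C c)" by metis
  then have C: "\<And>c. C c \<subseteq> {a\<in>A. f a k = c}" "\<And>c. finite (C c)"
      "\<And>c. \<forall>a\<in>{a\<in>A. f a k = c}. \<exists>b\<in>C c. \<forall>k\<in>K. f b k \<le> f a k"
    unfolding good_def by simp_all
  define m where "m = Max (insert 0 ((\<lambda>b. f b k) ` B0))"
  have m: "f b k \<le> m" if "b \<in> B0" for b
    unfolding m_def using that B0(2) by (intro Max_ge) auto
  show ?case
  proof (intro exI conjI ballI)
    show "B0 \<union> (\<Union>c<m. C c) \<subseteq> A" using B0(1) C(1) by blast
    show "finite (B0 \<union> (\<Union>c<m. C c))" using B0(2) C(2) by blast
    fix a assume a: "a \<in> A"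
    show "\<exists>b\<in>B0 \<union> (\<Union>c<m. C c). \<forall>k\<in>insert k K. f b k \<le> f a k"
    proof (cases "f a k < m")
      case True
      obtain b where b: "b \<in> C (f a k)" "\<forall>k\<in>K. f b k \<le> f a k" using C(3) a by blast
      then have "f b k = f a k" using C(1) by blast
      then show ?thesis using b True by (intro bexI[of _ b]) auto
    next
      case False
      obtain b where b: "b \<in> B0" "\<forall>k\<in>K. f b k \<le> f a k" using B0(3) a by blast
      then show ?thesis using m[of b] False by (intro bexI[of _ b]) auto
    qed
  qed
qed

section \<open>Sums of a polytope and a finitely generated cone\<close>

lemma polyhedron_slice:
  fixes K :: "('a::euclidean_space \<times> real) set"
  assumes "polyhedron K"
  shows "polyhedron {x. (x, 1) \<in> K}"
proof -
  obtain F where F: "finite F" "K = \<Inter>F" "\<And>h. h \<in> F \<Longrightarrow> \<exists>a b. a \<noteq> 0 \<and> h = {x. a \<bullet> x \<le> b}"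
    using assms unfolding polyhedron_def by blast
  have "polyhedron {x. (x, 1) \<in> h}" if hF: "h \<in> F" for h
  proof -
    obtain a b where h: "h = {x. a \<bullet> x \<le> b}" using F(3)[OF hF] by blast
    obtain c s where a: "a = (c, s)" by (cases a)
    \<comment> \<open>The part \<open>c\<close> of the normal may vanish; the slice is then empty or
      the whole space, still of the form of a half-space inequality.\<close>
    have eq: "{x. (x, 1) \<in> h} = {x. c \<bullet> x \<le> b - s}" by (auto simp: h a inner_Pair)
    show ?thesis unfolding eq by (rule polyhedron_halfspace_le)
  qed
  then have "polyhedron (\<Inter>h\<in>F. {x. (x, 1) \<in> h})"
    using F(1) by (intro polyhedron_Inter) auto
  also have "(\<Inter>h\<in>F. {x. (x, 1) \<in> h}) = {x. (x, 1) \<in> K}" using F(2) by auto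
  finally show ?thesis .
qed

text \<open>The Minkowski-Weyl form of a polyhedron. \<open>convex_cone hull T\<close> always
  contains 0, so an empty \<open>T\<close> leaves the plain convex hull, while an empty
  \<open>S\<close> makes the sum empty.\<close>

definition conv_cone :: "'a::real_vector set \<Rightarrow> 'a set \<Rightarrow> 'a set" where
  "conv_cone S T = {x + y | x y. x \<in> convex hull S \<and> y \<in> convex_cone hull T}"

text \<open>Homogenisation: the sum is the slice at height 1 of a finitely generated cone.\<close>

lemma polyhedron_conv_cone:
  fixes S T :: "'a::euclidean_space set"
  assumes "finite S" "finite T"
  shows "polyhedron (conv_cone S T)"
proof -
  define K where "K = convex_cone hull (S \<times> {1::real} \<union> T \<times> {0})"
  have "polyhedron K"
    unfolding K_def using assms by (intro polyhedron_convex_cone_hull) auto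
  have T: "convex_cone hull (T \<times> {0::real}) = (convex_cone hull T) \<times> {0}"
  proof -
    have lin: "linear (\<lambda>x::'a. (x, 0::real))" by (auto intro!: linearI)
    have im: "X \<times> {0::real} = (\<lambda>x. (x, 0)) ` X" for X :: "'a set" by auto
    show ?thesis unfolding im by (rule convex_cone_hull_linear_image[OF lin])
  qed
  \<comment> \<open>A point of this cone has its scaling factor as height, so height 1 in
    \<open>K\<close> forces the factor 1.\<close>
  have S: "convex_cone hull (S \<times> {1::real}) = insert 0 (\<Union>x\<in>(convex hull S) \<times> {1}. \<Union>c\<in>{0..}. {c *\<^sub>R x})"
    by (simp only: convex_cone_hull_convex_hull convex_hull_Times convex_hull_singleton)
  have "conv_cone S T = {x. (x, 1) \<in> K}"
    unfolding conv_cone_def K_def convex_cone_hull_Un T S by force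
  then show ?thesis using polyhedron_slice[OF \<open>polyhedron K\<close>] by simp
qed

lemma conv_coneI: "x \<in> convex hull S \<Longrightarrow> y \<in> convex_cone hull T \<Longrightarrow> x + y \<in> conv_cone S T"
  unfolding conv_cone_def by blast

lemma conv_coneE:
  assumes "x \<in> conv_cone S T"
  obtains y z where "x = y + z" "y \<in> convex hull S" "z \<in> convex_cone hull T"
  using assms unfolding conv_cone_def by blast

lemma hull_subset_conv_cone: "convex hull S \<subseteq> conv_cone S T"
  using conv_coneI[OF _ convex_cone_hull_contains_0] by fastforce

lemma subset_conv_cone: "S \<subseteq> conv_cone S T"
  using hull_subset_conv_cone hull_subset by (metis subset_trans)

lemma conv_cone_add:
  assumes "x \<in> conv_cone S T" "d \<in> convex_cone hull T"
  shows "x + d \<in> conv_cone S T"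
  using assms(1)
proof (rule conv_coneE)
  fix y z assume *: "x = y + z" "y \<in> convex hull S" "z \<in> convex_cone hull T"
  show "x + d \<in> conv_cone S T"
    using conv_coneI[OF *(2) convex_cone_hull_add[OF *(3) assms(2)]] *(1) by (simp add: add.assoc)
qed

text \<open>Strict separation from a closed convex set; a functional bounded below on the sum cannot
  decrease along a generator of the cone.\<close>

lemma conv_cone_separation:
  fixes S T :: "'a::euclidean_space set"
  assumes "finite S" "finite T" "x \<notin> conv_cone S T"
  obtains c \<gamma> where "c \<bullet> x < \<gamma>" "\<And>g. g \<in> S \<Longrightarrow> \<gamma> \<le> c \<bullet> g" "\<And>r. r \<in> T \<Longrightarrow> 0 \<le> c \<bullet> r"
proof (cases "S = {}")
  case True
  show ?thesis by (rule that[of 0 1]) (use True in auto)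
next
  case False
  have poly: "polyhedron (conv_cone S T)" using assms by (intro polyhedron_conv_cone)
  obtain c \<gamma> where c: "c \<bullet> x < \<gamma>" "\<forall>y\<in>conv_cone S T. \<gamma> < c \<bullet> y"
    using separating_hyperplane_closed_point[OF polyhedron_imp_convex[OF poly]
        polyhedron_imp_closed[OF poly] assms(3)] by blast
  have S: "g \<in> conv_cone S T" if "g \<in> S" for g
    using that subset_conv_cone by blast
  show ?thesis
  proof (rule that[OF c(1)])
    show "\<gamma> \<le> c \<bullet> g" if "g \<in> S" for g using bspec[OF c(2) S[OF that]] by simp
    fix r assume r: "r \<in> T"
    obtain g where g: "g \<in> S" using False by blast
    show "0 \<le> c \<bullet> r"
    proof (rule ccontr)
      assume neg: "\<not> 0 \<le> c \<bullet> r"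
      \<comment> \<open>At this \<open>t\<close> the ray from \<open>g\<close> reaches the level
        \<open>\<gamma>\<close> exactly, against the strict bound on the sum.\<close>
      define t where "t = (c \<bullet> g - \<gamma>) / - (c \<bullet> r)"
      have "c \<bullet> g > \<gamma>" using bspec[OF c(2) S[OF g]] .
      then have t: "t \<ge> 0" using neg by (auto simp: t_def divide_simps)
      have "g + t *\<^sub>R r \<in> conv_cone S T"
        using conv_cone_add[OF S[OF g]] convex_cone_hull_mul[OF hull_inc[OF r] t] by blast
      from bspec[OF c(2) this] have "\<gamma> < c \<bullet> g + t * (c \<bullet> r)" by (simp add: inner_add_right)
      also have "t * (c \<bullet> r) = \<gamma> - c \<bullet> g" using neg by (simp add: t_def field_simps)
      finally show False by simp
    qed
  qed
qed

section \<open>Exit rates and exit points\<close>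

text \<open>
  From a point \<open>v\<close> of the open polyhedron given by \<open>N\<close>, the ray in direction \<open>d\<close> leaves it at
  time \<open>1 / exit_rate N v d\<close>; rate \<open>0\<close> means that it never does.
\<close>

definition exit_rate :: "('a::euclidean_space \<times> real) set \<Rightarrow> 'a \<Rightarrow> 'a \<Rightarrow> real" where
  "exit_rate N v d = Max (insert 0 ((\<lambda>(a, b). - (a \<bullet> d) / (a \<bullet> v - b)) ` N))"

definition strict_sols :: "('a::euclidean_space \<times> real) set \<Rightarrow> 'a set" where
  "strict_sols N = {x. \<forall>(a, b)\<in>N. a \<bullet> x > b}"

text \<open>Candidate generators for the hull of what remains. Segments lead only to outer points of
  \<open>W\<close>, since a segment between two points of the convex set
  \<open>strict_sols N\<close> never leaves it; a direction of rate 0 contributes nothing.\<close>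

definition exit_points :: "('a::euclidean_space \<times> real) set \<Rightarrow> 'a set \<Rightarrow> 'a set \<Rightarrow> 'a set" where
  "exit_points N W E = (W - strict_sols N) \<union>
     {v + (1 / exit_rate N v d) *\<^sub>R d | v d. v \<in> W \<inter> strict_sols N \<and>
        d \<in> E \<union> (\<lambda>u. u - v) ` (W - strict_sols N) \<and> exit_rate N v d > 0}"

lemma exit_rate_nonneg: "finite N \<Longrightarrow> exit_rate N v d \<ge> 0"
  unfolding exit_rate_def by (intro Max_ge) auto

lemma exit_rate_ge: "finite N \<Longrightarrow> (a, b) \<in> N \<Longrightarrow> - (a \<bullet> d) / (a \<bullet> v - b) \<le> exit_rate N v d"
  unfolding exit_rate_def by (rule Max_ge) (auto intro: rev_image_eqI)

lemma exit_rate_cases: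
  assumes "finite N"
  obtains "exit_rate N v d = 0"
  | a b where "(a, b) \<in> N" "exit_rate N v d = - (a \<bullet> d) / (a \<bullet> v - b)"
proof -
  have "exit_rate N v d \<in> insert 0 ((\<lambda>(a, b). - (a \<bullet> d) / (a \<bullet> v - b)) ` N)"
    unfolding exit_rate_def using assms by (intro Max_in) auto
  then show ?thesis using that by auto
qed

text \<open>Dividing a row by its positive slack at \<open>v\<close> turns it into \<open>t\<close>
  times a row rate being less than 1, and the largest rate decides. The default 0 in the maximum is
  harmless because \<open>t * 0 < 1\<close>.\<close>

lemma ray_in_strict_sols_iff:
  assumes "finite N" "v \<in> strict_sols N" "t > 0"
  shows "v + t *\<^sub>R d \<in> strict_sols N \<longleftrightarrow> t * exit_rate N v d < 1"
proof
  have pos: "a \<bullet> v - b > 0" if "(a, b) \<in> N" for a b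
    using assms(2) that by (auto simp: strict_sols_def)
  have row: "a \<bullet> (v + t *\<^sub>R d) > b \<longleftrightarrow> t * (- (a \<bullet> d) / (a \<bullet> v - b)) < 1" if "(a, b) \<in> N" for a b
    using pos[OF that] by (simp add: inner_add_right field_simps)
  {
    assume l: "v + t *\<^sub>R d \<in> strict_sols N"
    show "t * exit_rate N v d < 1"
    proof (cases rule: exit_rate_cases[OF assms(1), of v d])
      case (2 a b)
      then show ?thesis using l row[of a b] by (auto simp: strict_sols_def)
    qed simp
  next
    assume r: "t * exit_rate N v d < 1"
    show "v + t *\<^sub>R d \<in> strict_sols N"
      unfolding strict_sols_def
    proof clarify
      fix a b assume ab: "(a, b) \<in> N"
      have "t * (- (a \<bullet> d) / (a \<bullet> v - b)) \<le> t * exit_rate N v d"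
        using exit_rate_ge[OF assms(1) ab] assms(3) by (intro mult_left_mono) auto
      then show "b < a \<bullet> (v + t *\<^sub>R d)" using row[OF ab] r by linarith
    qed
  }
qed

lemma finite_exit_points:
  assumes "finite W" "finite E"
  shows "finite (exit_points N W E)"
proof -
  let ?f = "\<lambda>(v, d). v + (1 / exit_rate N v d) *\<^sub>R d"
  have "exit_points N W E \<subseteq> W \<union> ?f ` (W \<times> (E \<union> (\<lambda>(u, v). u - v) ` (W \<times> W)))"
  proof
    fix x assume "x \<in> exit_points N W E"
    then consider "x \<in> W" | v d where "x = ?f (v, d)" "v \<in> W"
        "d \<in> E \<union> (\<lambda>u. u - v) ` (W - strict_sols N)"
      unfolding exit_points_def by auto
    then show "x \<in> W \<union> ?f ` (W \<times> (E \<union> (\<lambda>(u, v). u - v) ` (W \<times> W)))"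
    proof cases
      case (2 v d)
      then have "(v, d) \<in> W \<times> (E \<union> (\<lambda>(u, v). u - v) ` (W \<times> W))" by force
      then show ?thesis using 2(1) by blast
    qed simp
  qed
  then show ?thesis by (rule finite_subset) (use assms in auto)
qed

text \<open>
  The second system may have larger exit rates, i.e. earlier exits; taking \<open>N' = N\<close> recovers
  that the exit points lie outside their own open polyhedron.
\<close>

lemma exit_points_subset:
  assumes fin: "finite N" "finite N'"
    and W: "W \<inter> strict_sols N = W \<inter> strict_sols N'"
    and rate: "\<And>v d. v \<in> W \<inter> strict_sols N \<Longrightarrow> d \<in> E \<union> (\<lambda>u. u - v) ` W \<Longrightarrow>
       exit_rate N v d \<le> exit_rate N' v d"
  shows "exit_points N W E \<subseteq> conv_cone W E - strict_sols N'"
proof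
  have Wsub: "W \<subseteq> conv_cone W E"
    by (rule subset_conv_cone)
  fix x assume "x \<in> exit_points N W E"
  then consider "x \<in> W - strict_sols N"
    | v d where "x = v + (1 / exit_rate N v d) *\<^sub>R d" "v \<in> W \<inter> strict_sols N"
      "d \<in> E \<union> (\<lambda>u. u - v) ` (W - strict_sols N)" "exit_rate N v d > 0"
    unfolding exit_points_def by blast
  then show "x \<in> conv_cone W E - strict_sols N'"
  proof cases
    case 1
    then show ?thesis using W Wsub by blast
  next
    case 2
    define t where "t = 1 / exit_rate N v d"
    have t: "t > 0" using 2 by (simp add: t_def)
    have x: "x = v + t *\<^sub>R d" using 2 t_def by simp
    have v: "v \<in> strict_sols N'" "v \<in> conv_cone W E" using 2 W Wsub by blast+
    have "exit_rate N v d \<le> exit_rate N' v d" by (rule rate) (use 2 in auto)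
    then have "t * exit_rate N' v d \<ge> 1"
      using 2 unfolding t_def by (simp add: field_simps)
    then have out: "x \<notin> strict_sols N'"
      using ray_in_strict_sols_iff[OF fin(2) v(1) t] x by auto
    have "x \<in> conv_cone W E"
    proof (cases "d \<in> E")
      case True
      then show ?thesis unfolding x
        using conv_cone_add[OF v(2)] convex_cone_hull_mul[OF hull_inc[OF True]] t by auto
    next
      case False
      then obtain u where u: "u \<in> W" "u \<notin> strict_sols N" "d = u - v" using 2 by blast
      \<comment> \<open>The outer point \<open>u\<close> is reached at time 1, so the exit happens
        no later and the exit point lies on the segment from \<open>v\<close> to
        \<open>u\<close>.\<close>
      have "\<not> 1 * exit_rate N v d < 1"
        using ray_in_strict_sols_iff[OF fin(1), of v 1 d] 2 u by auto
      then have t1: "t \<le> 1" unfolding t_def by auto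
      have "x = (1 - t) *\<^sub>R v + t *\<^sub>R u" unfolding x u by (simp add: algebra_simps)
      moreover have "(1 - t) *\<^sub>R v + t *\<^sub>R u \<in> convex hull W"
        using t t1 2 u by (intro convexD[OF convex_convex_hull]) (auto intro: hull_inc)
      ultimately show ?thesis using hull_subset_conv_cone by blast
    qed
    then show ?thesis using out by blast
  qed
qed

section \<open>The hull of the remaining set in terms of exit points\<close>

text \<open>If no row decreases along a cone direction \<open>r\<close>, then by \<open>rec\<close>
  all rows are constant along it and a violated row stays violated. Otherwise some row is violated
  far out on the ray, and \<open>y + r\<close> lies between \<open>y\<close> and such a far
  point.\<close>

lemma hull_minus_strict_sols_add:
  assumes fin: "finite N"
    and rec: "\<And>d. \<forall>(a, b)\<in>N. a \<bullet> d \<ge> 0 \<Longrightarrow> \<forall>(a, b)\<in>N. a \<bullet> d = 0"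
    and x: "x \<in> convex hull (conv_cone W E - strict_sols N)" and d: "d \<in> convex_cone hull E"
  shows "x + d \<in> convex hull (conv_cone W E - strict_sols N)"
proof -
  let ?H = "convex hull (conv_cone W E - strict_sols N)"
  have ray: "y + r \<in> ?H" if y: "y \<in> conv_cone W E - strict_sols N" and r: "r \<in> convex_cone hull E" for y r
  proof (cases "\<forall>(a, b)\<in>N. a \<bullet> r \<ge> 0")
    case True
    then have 0: "\<forall>(a, b)\<in>N. a \<bullet> r = 0" by (rule rec)
    obtain a b where ab: "(a, b) \<in> N" "a \<bullet> y \<le> b" using y by (auto simp: strict_sols_def not_less)
    moreover have "a \<bullet> r = 0" using 0 ab(1) by blast
    ultimately have "y + r \<notin> strict_sols N" by (auto simp: strict_sols_def inner_add_right intro!: bexI[of _ "(a, b)"])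
    then show ?thesis using y r conv_cone_add by (intro hull_inc) auto
  next
    case False
    then obtain a b where ab: "(a, b) \<in> N" "a \<bullet> r < 0" by force
    define s where "s = max 1 ((a \<bullet> y - b) / - (a \<bullet> r))"
    have s: "s \<ge> 1" "a \<bullet> y + s * (a \<bullet> r) \<le> b"
    proof -
      show "s \<ge> 1" by (simp add: s_def)
      have "(a \<bullet> y - b) / - (a \<bullet> r) \<le> s" by (simp add: s_def)
      then show "a \<bullet> y + s * (a \<bullet> r) \<le> b" using ab(2) by (simp add: field_simps)
    qed
    then have "y + s *\<^sub>R r \<notin> strict_sols N"
      using ab by (auto simp: strict_sols_def inner_add_right intro!: bexI[of _ "(a, b)"])
    moreover have "y + s *\<^sub>R r \<in> conv_cone W E"
      using y s(1) convex_cone_hull_mul[OF r, of s] conv_cone_add by auto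
    ultimately have far: "y + s *\<^sub>R r \<in> ?H" by (intro hull_inc) auto
    have "y + r = (1 - 1 / s) *\<^sub>R y + (1 / s) *\<^sub>R (y + s *\<^sub>R r)"
      using s(1) by (simp add: algebra_simps)
    also have "\<dots> \<in> ?H"
      using s(1) far y by (intro convexD[OF convex_convex_hull]) (auto intro: hull_inc)
    finally show ?thesis .
  qed
  \<comment> \<open>Translation commutes with the convex hull, so \<open>ray\<close> for single
    points suffices.\<close>
  have "(\<lambda>y. d + y) ` (conv_cone W E - strict_sols N) \<subseteq> ?H"
    using ray d by (auto simp: add.commute)
  then have "convex hull ((\<lambda>y. d + y) ` (conv_cone W E - strict_sols N)) \<subseteq> ?H"
    by (intro hull_minimal) auto
  then show ?thesis using x unfolding convex_hull_translation by (auto simp: add.commute)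
qed

text \<open>
  If \<open>c\<close> separates \<open>x\<close> from the right-hand side and \<open>(a, b)\<close> is a row violated by \<open>x\<close>, then a
  suitable \<open>\<mu> \<ge> 0\<close> makes \<open>c \<bullet> y + \<mu> (a \<bullet> y - b) \<ge> \<gamma>\<close> valid on all of \<open>conv_cone W E\<close>: the lower
  bounds on \<open>\<mu>\<close> from generators with \<open>a \<bullet> v > b\<close> are compatible with the upper bounds from the
  other generators and from the rays exactly because \<open>c \<bullet> g \<ge> \<gamma>\<close> at the exit points \<open>g\<close>.
\<close>

lemma minus_strict_sols_subset:
  fixes W E :: "'a::euclidean_space set"
  assumes fin: "finite N" "finite W" "finite E"
  shows "conv_cone W E - strict_sols N \<subseteq> conv_cone (exit_points N W E) E"
proof (rule subsetI, rule ccontr)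
  fix x assume x: "x \<in> conv_cone W E - strict_sols N"
    and not: "x \<notin> conv_cone (exit_points N W E) E"
  obtain a b where ab: "(a, b) \<in> N" "a \<bullet> x \<le> b"
    using x by (auto simp: strict_sols_def not_less)
  obtain c \<gamma> where c: "c \<bullet> x < \<gamma>" "\<And>g. g \<in> exit_points N W E \<Longrightarrow> \<gamma> \<le> c \<bullet> g"
      "\<And>r. r \<in> E \<Longrightarrow> 0 \<le> c \<bullet> r"
    using conv_cone_separation[OF finite_exit_points[OF fin(2,3)] fin(3) not] by blast
  \<comment> \<open>\<open>l v\<close> is the least multiplier for which a generator with
    \<open>a \<bullet> v > b\<close> satisfies the combined inequality; \<open>\<mu>\<close> is the
    least nonnegative multiplier meeting all these bounds.\<close>
  define l where "l v = (\<gamma> - c \<bullet> v) / (a \<bullet> v - b)" for v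
  define \<mu> where "\<mu> = Max (insert 0 (l ` {v\<in>W. a \<bullet> v > b}))"
  have finl: "finite (insert 0 (l ` {v\<in>W. a \<bullet> v > b}))" using fin by auto
  have \<mu>0: "\<mu> \<ge> 0" unfolding \<mu>_def using finl by (intro Max_ge) auto
  have \<mu>l: "l v \<le> \<mu>" if "v \<in> W" "a \<bullet> v > b" for v
    unfolding \<mu>_def using finl that by (intro Max_ge) auto
  have "\<mu> \<in> insert 0 (l ` {v\<in>W. a \<bullet> v > b})"
    unfolding \<mu>_def using finl by (intro Max_in) auto
  \<comment> \<open>A positive \<open>\<mu>\<close> is attained at a generator with
    \<open>c \<bullet> v < \<gamma>\<close>, as \<open>slope\<close> requires.\<close>
  then have \<mu>_cases: "\<mu> = 0 \<or> (\<exists>v\<in>W. a \<bullet> v > b \<and> c \<bullet> v < \<gamma> \<and> \<mu> = l v)"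
  proof (cases "\<mu> = 0")
    case False
    then obtain v where v: "v \<in> W" "a \<bullet> v > b" "\<mu> = l v"
      using \<open>\<mu> \<in> _\<close> by auto
    then have "l v > 0" using False \<mu>0 by simp
    then have "c \<bullet> v < \<gamma>" using v(2) by (simp add: l_def zero_less_divide_iff)
    then show ?thesis using v by blast
  qed simp
  \<comment> \<open>The bound \<open>\<gamma>\<close> at the exit point from \<open>v\<close> along
    \<open>d\<close> limits the decrease of \<open>c\<close> by the exit rate, which is at least the
    rate of the row \<open>(a, b)\<close>.\<close>
  have slope: "c \<bullet> d + l v * (a \<bullet> d) \<ge> 0"
    if v: "v \<in> W" "a \<bullet> v > b" "c \<bullet> v < \<gamma>" and d: "a \<bullet> d < 0"
      "d \<in> E \<union> (\<lambda>u. u - v) ` (W - strict_sols N)" for v d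
  proof -
    let ?\<rho> = "exit_rate N v d"
    \<comment> \<open>Otherwise \<open>v\<close> would itself be an exit point, giving
      \<open>c \<bullet> v \<ge> \<gamma>\<close>.\<close>
    have vin: "v \<in> strict_sols N"
      using c(2)[of v] v unfolding exit_points_def by force
    have \<rho>: "?\<rho> \<ge> - (a \<bullet> d) / (a \<bullet> v - b)" by (rule exit_rate_ge[OF fin(1) ab(1)])
    moreover have "- (a \<bullet> d) / (a \<bullet> v - b) > 0" using v d by (intro divide_pos_pos) auto
    ultimately have pos: "?\<rho> > 0" by linarith
    then have "v + (1 / ?\<rho>) *\<^sub>R d \<in> exit_points N W E"
      using vin v d unfolding exit_points_def by blast
    then have "\<gamma> \<le> c \<bullet> v + (c \<bullet> d) / ?\<rho>" using c(2) by (force simp: inner_add_right)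
    then have "c \<bullet> d \<ge> (\<gamma> - c \<bullet> v) * ?\<rho>" using pos by (simp add: field_simps)
    moreover have "(\<gamma> - c \<bullet> v) * ?\<rho> \<ge> (\<gamma> - c \<bullet> v) * (- (a \<bullet> d) / (a \<bullet> v - b))"
      using \<rho> v by (intro mult_left_mono) auto
    ultimately show ?thesis by (simp add: l_def)
  qed
  have E: "c \<bullet> r + \<mu> * (a \<bullet> r) \<ge> 0" if r: "r \<in> E" for r
  proof (cases "a \<bullet> r < 0")
    case True
    then show ?thesis using \<mu>_cases slope[of _ r] r c(3)[OF r] by auto
  next
    case False
    then show ?thesis using \<mu>0 c(3)[OF r] by auto
  qed
  have W: "c \<bullet> u + \<mu> * (a \<bullet> u - b) \<ge> \<gamma>" if u: "u \<in> W" for u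
  proof (cases "a \<bullet> u > b")
    case True
    then have "\<gamma> - c \<bullet> u = l u * (a \<bullet> u - b)" by (simp add: l_def)
    also have "\<dots> \<le> \<mu> * (a \<bullet> u - b)" using \<mu>l[OF u True] True by (intro mult_right_mono) auto
    finally show ?thesis by simp
  next
    case False
    then have uout: "u \<in> W - strict_sols N" using u ab(1) by (auto simp: strict_sols_def)
    then have cu: "c \<bullet> u \<ge> \<gamma>" by (intro c(2)) (simp add: exit_points_def)
    show ?thesis
    proof (cases "\<mu> = 0")
      case False
      then obtain v where v: "v \<in> W" "a \<bullet> v > b" "c \<bullet> v < \<gamma>" "\<mu> = l v" using \<mu>_cases by blast
      \<comment> \<open>The combined inequality is tight at \<open>v\<close>, and by
        \<open>slope\<close> its left side does not decrease from \<open>v\<close> to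
        \<open>u\<close>.\<close>
      have "c \<bullet> (u - v) + l v * (a \<bullet> (u - v)) \<ge> 0"
        using \<open>\<not> a \<bullet> u > b\<close> v uout by (intro slope) (auto simp: inner_diff_right)
      moreover have "l v * (a \<bullet> v - b) = \<gamma> - c \<bullet> v" using v by (simp add: l_def)
      ultimately show ?thesis using v(4) by (simp add: inner_diff_right algebra_simps)
    qed (use cu in simp)
  qed
  obtain y z where yz: "x = y + z" "y \<in> convex hull W" "z \<in> convex_cone hull E" using x by (blast elim: conv_coneE)
  have "convex hull W \<subseteq> {y. (c + \<mu> *\<^sub>R a) \<bullet> y \<ge> \<gamma> + \<mu> * b}"
  proof (rule hull_minimal)
    show "W \<subseteq> {y. (c + \<mu> *\<^sub>R a) \<bullet> y \<ge> \<gamma> + \<mu> * b}"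
      using W by (force simp: inner_add_left algebra_simps)
  qed (rule convex_halfspace_ge)
  moreover have "convex_cone hull E \<subseteq> {z. (c + \<mu> *\<^sub>R a) \<bullet> z \<ge> 0}"
  proof (rule hull_minimal)
    show "E \<subseteq> {z. (c + \<mu> *\<^sub>R a) \<bullet> z \<ge> 0}" using E by (auto simp: inner_add_left)
  qed (rule convex_cone_halfspace_ge)
  ultimately have "(c + \<mu> *\<^sub>R a) \<bullet> y \<ge> \<gamma> + \<mu> * b" "(c + \<mu> *\<^sub>R a) \<bullet> z \<ge> 0" using yz by auto
  then have "c \<bullet> x + \<mu> * (a \<bullet> x) \<ge> \<gamma> + \<mu> * b"
    unfolding yz(1) by (simp add: inner_add_left inner_add_right algebra_simps)
  moreover have "\<mu> * (a \<bullet> x) \<le> \<mu> * b" using ab(2) \<mu>0 by (intro mult_left_mono) auto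
  ultimately show False using c(1) by linarith
qed

text \<open>One inclusion is the separation argument, the target being convex. For the other, exit
  points lie in the remaining set and its hull is closed under adding cone directions.\<close>

lemma hull_minus_strict_sols_eq:
  assumes fin: "finite N" "finite W" "finite E"
    and rec: "\<And>d. \<forall>(a, b)\<in>N. a \<bullet> d \<ge> 0 \<Longrightarrow> \<forall>(a, b)\<in>N. a \<bullet> d = 0"
  shows "convex hull (conv_cone W E - strict_sols N) = conv_cone (exit_points N W E) E"
proof
  show "convex hull (conv_cone W E - strict_sols N) \<subseteq> conv_cone (exit_points N W E) E"
    by (intro hull_minimal minus_strict_sols_subset polyhedron_imp_convex polyhedron_conv_cone
        finite_exit_points fin)
  have "convex hull (exit_points N W E) \<subseteq> convex hull (conv_cone W E - strict_sols N)"
    by (intro hull_mono exit_points_subset fin) auto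
  then show "conv_cone (exit_points N W E) E \<subseteq> convex hull (conv_cone W E - strict_sols N)"
    using hull_minus_strict_sols_add[OF fin(1) rec] by (blast elim: conv_coneE)
qed

text \<open>Exit points of \<open>N\<close> come no earlier than those of \<open>N'\<close> and so
  lie outside the open set of \<open>N'\<close>; together with the cone they generate the left-hand
  hull.\<close>

lemma hull_minus_strict_sols_mono:
  assumes fin: "finite N" "finite N'" "finite W" "finite E"
    and rec: "\<And>d. \<forall>(a, b)\<in>N. a \<bullet> d \<ge> 0 \<Longrightarrow> \<forall>(a, b)\<in>N. a \<bullet> d = 0"
    and rec': "\<And>d. \<forall>(a, b)\<in>N'. a \<bullet> d \<ge> 0 \<Longrightarrow> \<forall>(a, b)\<in>N'. a \<bullet> d = 0"
    and W: "W \<inter> strict_sols N = W \<inter> strict_sols N'"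
    and rate: "\<And>v d. v \<in> W \<inter> strict_sols N \<Longrightarrow> d \<in> E \<union> (\<lambda>u. u - v) ` W \<Longrightarrow>
       exit_rate N v d \<le> exit_rate N' v d"
  shows "convex hull (conv_cone W E - strict_sols N) \<subseteq> convex hull (conv_cone W E - strict_sols N')"
proof -
  have "convex hull (exit_points N W E) \<subseteq> convex hull (conv_cone W E - strict_sols N')"
    by (intro hull_mono exit_points_subset fin W rate)
  moreover have "x + d \<in> convex hull (conv_cone W E - strict_sols N')"
    if "x \<in> convex hull (conv_cone W E - strict_sols N')" "d \<in> convex_cone hull E" for x d
    using fin(2) rec' that by (rule hull_minus_strict_sols_add)
  ultimately have "conv_cone (exit_points N W E) E \<subseteq> convex hull (conv_cone W E - strict_sols N')"
    by (blast elim: conv_coneE)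
  moreover have "convex hull (conv_cone W E - strict_sols N) = conv_cone (exit_points N W E) E"
    using fin(1,3,4) rec by (rule hull_minus_strict_sols_eq)
  ultimately show ?thesis by simp
qed

section \<open>Facet representations\<close>

lemma finite_rats_common_denominator:
  fixes X :: "real set"
  assumes "finite X" "X \<subseteq> \<rat>"
  shows "\<exists>D::nat. D > 0 \<and> (\<forall>x\<in>X. real D * x \<in> \<int>)"
  using assms
proof (induction X rule: finite_induct)
  case empty
  show ?case by (intro exI[of _ 1]) auto
next
  case (insert x X)
  then obtain D where D: "D > 0" "\<forall>x\<in>X. real D * x \<in> \<int>" by auto
  obtain i k :: int where "k > 0" "x = of_int i / of_int k"
    using insert.prems by (auto elim!: Rats_cases')
  then obtain n :: nat where x: "n > 0" "x = of_int i / of_nat n"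
    by (metis of_int_of_nat_eq zero_less_imp_eq_int)
  show ?case
  proof (intro exI[of _ "n * D"] conjI ballI)
    show "0 < n * D" using x(1) D(1) by simp
    fix y assume y: "y \<in> insert x X"
    show "real (n * D) * y \<in> \<int>"
    proof (cases "y = x")
      case True
      have "real (n * D) * y = of_int (int D * i)" using x True by simp
      then show ?thesis by (metis Ints_of_int)
    next
      case False
      then have "real D * y \<in> \<int>" using D(2) y by blast
      then have "real n * (real D * y) \<in> \<int>" by (rule Ints_mult[OF Ints_of_nat])
      then show ?thesis by (simp add: mult.assoc)
    qed
  qed
qed

lemma real_vec_nth [simp]: "real_vec \<pi> $ j = of_int (\<pi> $ j)"
  by (simp add: real_vec_def)

lemma real_vec_0 [simp]: "real_vec 0 = 0"
  by (simp add: vec_eq_iff)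

lemma real_vec_eq_0_iff [simp]: "real_vec \<pi> = 0 \<longleftrightarrow> \<pi> = 0"
  by (simp add: vec_eq_iff)

definition primitive_row :: "('p::finite \<Rightarrow> 'n::finite) \<Rightarrow> (int^'n) \<times> int \<Rightarrow> bool" where
  "primitive_row \<iota> = (\<lambda>(\<pi>, \<pi>0). (\<forall>j. j \<notin> range \<iota> \<longrightarrow> \<pi> $ j = 0) \<and>
     Gcd (insert \<pi>0 (range (\<lambda>i. \<pi> $ \<iota> i))) = 1)"

text \<open>Clear denominators, then divide by the gcd \<open>g\<close>. It is positive because
  \<open>a\<close> has a nonzero coordinate, necessarily in \<open>range \<iota>\<close>.\<close>

lemma primitive_row_exists:
  fixes \<iota> :: "'p::finite \<Rightarrow> 'n::finite" and a :: "real^'n"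
  assumes "\<And>j. a $ j \<in> \<rat>" "b \<in> \<rat>" "a \<noteq> 0" "\<And>j. j \<notin> range \<iota> \<Longrightarrow> a $ j = 0"
  obtains \<pi> \<pi>0 c where "c > 0" "real_vec \<pi> = c *\<^sub>R a" "of_int \<pi>0 = c * b"
    "primitive_row \<iota> (\<pi>, \<pi>0)"
proof -
  obtain D :: nat where D: "D > 0" "real D * b \<in> \<int>" "\<And>j. real D * a $ j \<in> \<int>"
    using finite_rats_common_denominator[of "insert b (range (\<lambda>j. a $ j))"] assms(1,2) by auto
  have "\<exists>k. real D * a $ j = of_int k" for j using D(3)[of j] by (auto elim: Ints_cases)
  then obtain \<rho> where \<rho>: "\<And>j. real D * a $ j = of_int (\<rho> j)" by metis
  obtain \<rho>0 where \<rho>0: "real D * b = of_int \<rho>0" using D(2) by (auto elim: Ints_cases)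
  define g where "g = Gcd (insert \<rho>0 (range (\<lambda>i. \<rho> (\<iota> i))))"
  obtain j where j: "a $ j \<noteq> 0" using assms(3) by (auto simp: vec_eq_iff)
  then obtain i where i: "j = \<iota> i" using assms(4) by blast
  have "\<rho> (\<iota> i) \<noteq> 0" using \<rho>[of j] j D(1) i by auto
  then have "g \<noteq> 0" unfolding g_def by auto
  moreover have "g \<ge> 0" unfolding g_def by simp
  ultimately have g: "g > 0" by simp
  have gd: "g dvd \<rho>0" "g dvd \<rho> j" for j
  proof -
    show "g dvd \<rho>0" unfolding g_def by (rule Gcd_dvd) simp
    show "g dvd \<rho> j"
    proof (cases "j \<in> range \<iota>")
      case True
      then show ?thesis unfolding g_def by (intro Gcd_dvd) auto
    next
      case False
      then show ?thesis using \<rho>[of j] assms(4)[of j] by simp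
    qed
  qed
  define \<pi> where "\<pi> = (\<chi> j. \<rho> j div g)"
  define \<pi>0 where "\<pi>0 = \<rho>0 div g"
  have "insert \<rho>0 (range (\<lambda>i. \<rho> (\<iota> i))) = (*) g ` insert \<pi>0 (range (\<lambda>i. \<pi> $ \<iota> i))"
    unfolding image_insert image_image using gd by (simp add: \<pi>_def \<pi>0_def)
  then have "g = normalize (g * Gcd (insert \<pi>0 (range (\<lambda>i. \<pi> $ \<iota> i))))"
    unfolding g_def using Gcd_mult by metis
  then have "g * Gcd (insert \<pi>0 (range (\<lambda>i. \<pi> $ \<iota> i))) = g * 1"
    using g by (simp add: abs_mult)
  then have 1: "Gcd (insert \<pi>0 (range (\<lambda>i. \<pi> $ \<iota> i))) = 1"
    using g by (simp del: Gcd_insert)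
  have prim: "primitive_row \<iota> (\<pi>, \<pi>0)"
  proof -
    have "\<pi> $ j = 0" if "j \<notin> range \<iota>" for j
      using \<rho>[of j] assms(4)[OF that] by (simp add: \<pi>_def)
    then show ?thesis using 1 by (simp add: primitive_row_def)
  qed
  have eq: "real_of_int (k div g) = of_int k / of_int g" if "g dvd k" for k
    using that by (simp add: real_of_int_div)
  show ?thesis
  proof (rule that[of "real D / of_int g" \<pi> \<pi>0])
    show "real D / of_int g > 0" using D(1) g by simp
    show "real_vec \<pi> = (real D / of_int g) *\<^sub>R a"
      using \<rho> by (simp add: vec_eq_iff \<pi>_def eq gd)
    show "of_int \<pi>0 = real D / of_int g * b"
      using \<rho>0 by (simp add: \<pi>0_def eq gd)
  qed (rule prim)
qed

text \<open>The factor is a quotient \<open>s / t\<close> of positive integers, so \<open>t\<close>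
  times one row is \<open>s\<close> times the other; comparing gcds gives
  \<open>s = t\<close>.\<close>

lemma primitive_row_unique:
  fixes \<iota> :: "'p::finite \<Rightarrow> 'n::finite"
  assumes "primitive_row \<iota> (\<pi>, \<pi>0)" "primitive_row \<iota> (\<rho>, \<rho>0)" "\<rho> \<noteq> 0" "c > 0"
    and eq: "real_vec \<rho> = c *\<^sub>R real_vec \<pi>" "of_int \<rho>0 = c * of_int \<pi>0"
  shows "\<pi> = \<rho> \<and> \<pi>0 = \<rho>0"
proof -
  obtain j where j: "\<rho> $ j \<noteq> 0" using assms(3) by (auto simp: vec_eq_iff)
  have eqj: "of_int (\<rho> $ j) = c * of_int (\<pi> $ j)" for j
    using arg_cong[OF eq(1), of "\<lambda>v. v $ j"] by simp
  have \<pi>j: "\<pi> $ j \<noteq> 0" using eqj[of j] j by auto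
  have cq: "of_int \<bar>\<rho> $ j\<bar> = c * of_int \<bar>\<pi> $ j\<bar>"
    using eqj[of j] \<open>c > 0\<close> by (simp add: abs_mult)
  define s t where "s = \<bar>\<rho> $ j\<bar>" "t = \<bar>\<pi> $ j\<bar>"
  have st: "s > 0" "t > 0" "c = of_int s / of_int t"
    using cq j \<pi>j by (auto simp: s_t_def)
  have lin: "t * y = s * x" if "of_int y = c * of_int x" for x y :: int
  proof -
    have "real_of_int (t * y) = of_int (s * x)" using that st by (simp add: field_simps)
    then show ?thesis by linarith
  qed
  have G: "Gcd (insert \<pi>0 (range (\<lambda>i. \<pi> $ \<iota> i))) = 1" "Gcd (insert \<rho>0 (range (\<lambda>i. \<rho> $ \<iota> i))) = 1"
    using assms(1,2) by (auto simp: primitive_row_def simp del: Gcd_insert)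
  have "(*) t ` insert \<rho>0 (range (\<lambda>i. \<rho> $ \<iota> i)) = (*) s ` insert \<pi>0 (range (\<lambda>i. \<pi> $ \<iota> i))"
    unfolding image_insert image_image using lin[OF eq(2)] lin[OF eqj] by simp
  then have "normalize (t * 1) = normalize (s * 1)" using G Gcd_mult by metis
  then have "s = t" using st by simp
  then have "c = 1" using st by simp
  then show ?thesis using eqj eq(2) by (simp add: vec_eq_iff)
qed

section \<open>Rows and facets of a full-dimensional polyhedron\<close>

lemma interior_halfspaces:
  fixes N :: "('a::euclidean_space \<times> real) set"
  assumes "finite N" "\<And>a b. (a, b) \<in> N \<Longrightarrow> a \<noteq> 0"
  shows "interior {x. \<forall>(a, b)\<in>N. a \<bullet> x \<ge> b} = {x. \<forall>(a, b)\<in>N. a \<bullet> x > b}"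
  using assms
proof (induction N rule: finite_induct)
  case (insert n N)
  obtain a b where n: "n = (a, b)" by (cases n)
  have 1: "{x. \<forall>(a, b)\<in>insert n N. a \<bullet> x \<ge> b} = {x. a \<bullet> x \<ge> b} \<inter> {x. \<forall>(a, b)\<in>N. a \<bullet> x \<ge> b}"
    by (auto simp: n)
  have "a \<noteq> 0" using insert.prems n by blast
  moreover have "interior {x. \<forall>(a, b)\<in>N. a \<bullet> x \<ge> b} = {x. \<forall>(a, b)\<in>N. a \<bullet> x > b}"
    using insert.prems by (intro insert.IH) blast
  ultimately show ?case unfolding 1 interior_Int by (auto simp: n)
qed simp

text \<open>A facet of a full-dimensional set spans a hyperplane, so both rows define the same
  hyperplane and their normals are proportional; validity on \<open>L\<close> fixes the
  sign.\<close>

lemma facet_determines_row: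
  fixes L :: "(real^'n::finite) set"
  assumes int: "interior L \<noteq> {}"
    and facet: "(L \<inter> {x. a \<bullet> x = b}) facet_of L"
    and eq: "L \<inter> {x. a \<bullet> x = b} = L \<inter> {x. a' \<bullet> x = b'}"
    and valid: "\<And>x. x \<in> L \<Longrightarrow> a \<bullet> x \<ge> b" "\<And>x. x \<in> L \<Longrightarrow> a' \<bullet> x \<ge> b'"
    and nz: "a \<noteq> 0" "a' \<noteq> 0"
  obtains c where "c > 0" "a' = c *\<^sub>R a" "b' = c * b"
proof -
  let ?F = "L \<inter> {x. a \<bullet> x = b}"
  have dimL: "aff_dim L = int CARD('n)"
    using aff_dim_nonempty_interior[OF int] by simp
  have F: "?F \<noteq> {}" "aff_dim ?F = int CARD('n) - 1" using facet dimL by (auto simp: facet_of_def)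
  have aff: "affine hull ?F = {x. p \<bullet> x = q}" if "p \<noteq> 0" "?F \<subseteq> {x. p \<bullet> x = q}" for p q
  proof (rule affine_dim_equal)
    show "affine hull ?F \<subseteq> {x. p \<bullet> x = q}"
      using that(2) by (intro hull_minimal affine_hyperplane) auto
    show "aff_dim (affine hull ?F) = aff_dim {x. p \<bullet> x = q}"
      unfolding aff_dim_affine_hull F(2) using aff_dim_hyperplane[OF that(1), of q] by simp
    show "affine hull ?F \<noteq> {}" using F(1) by (simp only: affine_hull_eq_empty not_False_eq_True)
  qed (rule affine_affine_hull affine_hyperplane)+
  have "?F \<subseteq> {x. a' \<bullet> x = b'}" unfolding eq by blast
  then have H: "{x. a \<bullet> x = b} = {x. a' \<bullet> x = b'}" using aff[OF nz(1) Int_lower2] aff[OF nz(2)] by blast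
  obtain x0 where x0: "a \<bullet> x0 = b" "a' \<bullet> x0 = b'" using F(1) eq by blast
  define c where "c = (a' \<bullet> a) / (a \<bullet> a)"
  \<comment> \<open>The component of \<open>a'\<close> orthogonal to \<open>a\<close>: moving
    \<open>x0\<close> by it stays in the common hyperplane, so it is orthogonal to \<open>a'\<close>
    as well and vanishes.\<close>
  define y where "y = a' - c *\<^sub>R a"
  have ay: "a \<bullet> y = 0" using nz by (simp add: y_def c_def inner_diff_right inner_commute)
  then have "x0 + y \<in> {x. a' \<bullet> x = b'}" using x0 unfolding H[symmetric] by (simp add: inner_add_right)
  then have "a' \<bullet> y = 0" using x0 by (simp add: inner_add_right)
  then have "y \<bullet> y = 0" using ay by (simp add: y_def inner_diff_left)
  then have a': "a' = c *\<^sub>R a" by (simp add: y_def)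
  have b': "b' = c * b" using x0 a' by simp
  have "c \<noteq> 0" using nz a' by auto
  moreover have "c \<ge> 0"
  proof (rule ccontr)
    \<comment> \<open>With a negative factor the two valid rows are opposite, which confines
      \<open>L\<close> to a hyperplane.\<close>
    assume neg: "\<not> c \<ge> 0"
    have "a \<bullet> x = b" if "x \<in> L" for x
    proof -
      have "c * (a \<bullet> x) \<ge> c * b" using valid(2)[OF that] a' b' by simp
      then have "a \<bullet> x \<le> b" using neg by (simp add: mult_le_cancel_left)
      then show ?thesis using valid(1)[OF that] by simp
    qed
    then have "L \<subseteq> {x. a \<bullet> x = b}" by blast
    then show False using interior_mono int nz(1) by (metis interior_hyperplane subset_empty)
  qed
  ultimately have "c > 0" by simp
  then show ?thesis using a' b' by (rule that)
qed

lemma facet_representation_rows: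
  assumes rep: "facet_representation \<iota> L N" and mem: "(\<pi>, \<pi>0) \<in> N"
  shows "(L \<inter> {x. real_vec \<pi> \<bullet> x = of_int \<pi>0}) facet_of L"
    and "x \<in> L \<Longrightarrow> real_vec \<pi> \<bullet> x \<ge> of_int \<pi>0"
    and "primitive_row \<iota> (\<pi>, \<pi>0)"
    and "\<pi> \<noteq> 0"
proof -
  have "bij_betw (\<lambda>(\<pi>, \<pi>0). L \<inter> {x. real_vec \<pi> \<bullet> x = of_int \<pi>0}) N {F. F facet_of L}"
    using rep unfolding facet_representation_def by blast
  from bij_betw_apply[OF this mem] show f: "(L \<inter> {x. real_vec \<pi> \<bullet> x = of_int \<pi>0}) facet_of L" by simp
  show "x \<in> L \<Longrightarrow> real_vec \<pi> \<bullet> x \<ge> of_int \<pi>0"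
    using rep mem unfolding facet_representation_def by blast
  show "primitive_row \<iota> (\<pi>, \<pi>0)"
    using rep mem unfolding facet_representation_def primitive_row_def by blast
  show "\<pi> \<noteq> 0"
  proof
    assume "\<pi> = 0"
    \<comment> \<open>A zero normal cuts out nothing or all of \<open>L\<close>, neither of which is
      a facet.\<close>
    then have "L \<inter> {x. real_vec \<pi> \<bullet> x = of_int \<pi>0} \<in> {{}, L}" by auto
    then show False using f by (auto simp: facet_of_def)
  qed
qed

text \<open>Each facet determines its primitive row. Exchanging \<open>N\<close> and
  \<open>N'\<close> yields uniqueness of the representation.\<close>

lemma facet_representation_subset:
  assumes int: "interior L \<noteq> {}"
    and N: "facet_representation \<iota> L N" and N': "facet_representation \<iota> L N'"
  shows "N \<subseteq> N'"
proof clarify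
  fix \<pi> \<pi>0 assume mem: "(\<pi>, \<pi>0) \<in> N"
  note row = facet_representation_rows[OF N mem]
  have "bij_betw (\<lambda>(\<pi>, \<pi>0). L \<inter> {x. real_vec \<pi> \<bullet> x = of_int \<pi>0}) N' {F. F facet_of L}"
    using N' unfolding facet_representation_def by blast
  then have "L \<inter> {x. real_vec \<pi> \<bullet> x = of_int \<pi>0} \<in>
      (\<lambda>(\<pi>, \<pi>0). L \<inter> {x. real_vec \<pi> \<bullet> x = of_int \<pi>0}) ` N'"
    using row(1) by (simp add: bij_betw_def)
  then obtain \<rho> \<rho>0 where mem': "(\<rho>, \<rho>0) \<in> N'" and
      eq: "L \<inter> {x. real_vec \<pi> \<bullet> x = of_int \<pi>0} = L \<inter> {x. real_vec \<rho> \<bullet> x = of_int \<rho>0}"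
    by auto
  note row' = facet_representation_rows[OF N' mem']
  obtain c where "c > 0" "real_vec \<rho> = c *\<^sub>R real_vec \<pi>" "of_int \<rho>0 = c * of_int \<pi>0"
    using facet_determines_row[OF int row(1) eq row(2) row'(2)] row(4) row'(4) by auto
  then have "\<pi> = \<rho> \<and> \<pi>0 = \<rho>0" by (intro primitive_row_unique[OF row(3) row'(3) row'(4)])
  then show "(\<pi>, \<pi>0) \<in> N'" using mem' by simp
qed

text \<open>Make all rows primitive and take a description of least cardinality; it is irredundant,
  so its rows correspond exactly to the facets.\<close>

lemma facet_representation_exists:
  fixes \<iota> :: "'p::finite \<Rightarrow> 'n::finite" and L :: "(real^'n) set"
  assumes int: "interior L \<noteq> {}" and fin: "finite F"
    and L: "L = {x. \<forall>(a, b)\<in>F. a \<bullet> x \<ge> b}"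
    and rat: "\<And>a b. (a, b) \<in> F \<Longrightarrow> (\<forall>j. a $ j \<in> \<rat>) \<and> b \<in> \<rat> \<and> (\<forall>j. j \<notin> range \<iota> \<longrightarrow> a $ j = 0)"
  obtains N where "finite N" "facet_representation \<iota> L N"
proof -
  define hs where "hs = (\<lambda>(\<pi> :: int^'n, \<pi>0). {x. real_vec \<pi> \<bullet> x \<ge> of_int \<pi>0})"
  define good where "good M \<longleftrightarrow> finite M \<and> L = (\<Inter>n\<in>M. hs n) \<and>
      (\<forall>n\<in>M. fst n \<noteq> 0 \<and> primitive_row \<iota> n)" for M
  have "\<exists>n. L \<subseteq> {x. a \<bullet> x \<ge> b} \<longrightarrow> hs n = {x. a \<bullet> x \<ge> b} \<and> fst n \<noteq> 0 \<and> primitive_row \<iota> n"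
    if ab: "(a, b) \<in> F" "a \<noteq> 0" for a b
  proof -
    obtain \<pi> \<pi>0 c where c: "c > 0" "real_vec \<pi> = c *\<^sub>R a" "of_int \<pi>0 = c * b"
        "primitive_row \<iota> (\<pi>, \<pi>0)"
      by (rule primitive_row_exists[of a b \<iota>]) (use rat[OF ab(1)] ab(2) in auto)
    have "hs (\<pi>, \<pi>0) = {x. a \<bullet> x \<ge> b}" using c(1) by (simp add: hs_def c(2,3))
    moreover have "\<pi> \<noteq> 0" using c(1,2) ab(2) by (metis real_vec_eq_0_iff scaleR_eq_0_iff less_irrefl)
    ultimately show ?thesis using c(4) by (intro exI[of _ "(\<pi>, \<pi>0)"]) simp
  qed
  then have "\<forall>ab\<in>{(a, b)\<in>F. a \<noteq> 0}. \<exists>n. hs n = {x. fst ab \<bullet> x \<ge> snd ab} \<and> fst n \<noteq> 0 \<and> primitive_row \<iota> n"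
    using L by fastforce
  from bchoice[OF this] obtain row where row:
    "\<And>a b. (a, b) \<in> F \<Longrightarrow> a \<noteq> 0 \<Longrightarrow> hs (row (a, b)) = {x. a \<bullet> x \<ge> b} \<and>
       fst (row (a, b)) \<noteq> 0 \<and> primitive_row \<iota> (row (a, b))" by auto
  \<comment> \<open>A point of \<open>L\<close> shows that rows with zero normal hold everywhere, so
    leaving them out keeps \<open>L\<close>.\<close>
  obtain x0 where x0: "x0 \<in> L" using int interior_subset by blast
  have "L = (\<Inter>n\<in>row ` {(a, b)\<in>F. a \<noteq> 0}. hs n)"
  proof
    show "L \<subseteq> (\<Inter>n\<in>row ` {(a, b)\<in>F. a \<noteq> 0}. hs n)" using row unfolding L by auto
    show "(\<Inter>n\<in>row ` {(a, b)\<in>F. a \<noteq> 0}. hs n) \<subseteq> L"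
    proof
      fix x assume x: "x \<in> (\<Inter>n\<in>row ` {(a, b)\<in>F. a \<noteq> 0}. hs n)"
      have "a \<bullet> x \<ge> b" if ab: "(a, b) \<in> F" for a b
      proof (cases "a = 0")
        case True
        then show ?thesis using x0 ab unfolding L by fastforce
      next
        case False
        then have "x \<in> hs (row (a, b))" using x ab by blast
        then show ?thesis using row[OF ab False] by simp
      qed
      then show "x \<in> L" unfolding L by blast
    qed
  qed
  moreover have "finite {(a, b)\<in>F. a \<noteq> 0}" using fin by (rule rev_finite_subset) auto
  ultimately have "good (row ` {(a, b)\<in>F. a \<noteq> 0})"
    unfolding good_def using row by blast
  from ex_has_least_nat[of good, OF this, of card]
  obtain N where N: "good N" and least: "\<And>M. good M \<Longrightarrow> card N \<le> card M" by blast
  have finN: "finite N" and LN: "L = (\<Inter>n\<in>N. hs n)"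
    and prim: "\<And>\<pi> \<pi>0. (\<pi>, \<pi>0) \<in> N \<Longrightarrow> \<pi> \<noteq> 0 \<and> primitive_row \<iota> (\<pi>, \<pi>0)"
    using N unfolding good_def by auto
  have irredundant: "L \<noteq> (\<Inter>n\<in>M. hs n)" if "M \<subset> N" for M
  proof
    assume "L = (\<Inter>n\<in>M. hs n)"
    moreover have "finite M" using that finN by (meson finite_subset psubset_imp_subset)
    moreover have "\<forall>n\<in>M. fst n \<noteq> 0 \<and> primitive_row \<iota> n" using that N unfolding good_def by blast
    ultimately have "good M" unfolding good_def by blast
    then show False using least[of M] psubset_card_mono[OF finN that] by linarith
  qed
  have inj: "inj_on hs N"
  proof (rule inj_onI, rule ccontr)
    fix m n assume mn: "m \<in> N" "n \<in> N" "hs m = hs n" "m \<noteq> n"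
    then have "hs ` N = hs ` (N - {m})" by (auto simp: image_iff)
    then have "L = (\<Inter>n\<in>N - {m}. hs n)" using LN by simp
    then show False using irredundant[of "N - {m}"] mn by blast
  qed
  define face where "face = (\<lambda>(\<pi>, \<pi>0). L \<inter> {x. real_vec \<pi> \<bullet> x = of_int \<pi>0})"
  define row_of where "row_of = the_inv_into N hs"
  have row_of: "row_of (hs n) = n" if "n \<in> N" for n
    unfolding row_of_def by (rule the_inv_into_f_f[OF inj that])
  have affL: "affine hull L = UNIV" using affine_hull_nonempty_interior[OF int] .
  \<comment> \<open>\<open>facet_of_polyhedron_explicit\<close> takes half-spaces with \<le>, hence
    the negated rows; \<open>row_of\<close> recovers the row from its half-space.\<close>
  have facets: "C facet_of L \<longleftrightarrow> (\<exists>h. h \<in> hs ` N \<and>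
      C = L \<inter> {x. - real_vec (fst (row_of h)) \<bullet> x = - of_int (snd (row_of h))})" for C
  proof (rule facet_of_polyhedron_explicit)
    show "finite (hs ` N)" using finN by simp
    show "L = affine hull L \<inter> \<Inter> (hs ` N)" using LN affL by simp
    show "- real_vec (fst (row_of h)) \<noteq> 0 \<and>
        h = {x. - real_vec (fst (row_of h)) \<bullet> x \<le> - of_int (snd (row_of h))}"
      if "h \<in> hs ` N" for h
      using that row_of prim by (force simp: hs_def)
    fix F' assume F': "F' \<subset> hs ` N"
    define M where "M = {n\<in>N. hs n \<in> F'}"
    have "F' = hs ` M" using F' by (auto simp: M_def)
    moreover have "M \<subset> N" using F' by (auto simp: M_def)
    ultimately have "L \<noteq> \<Inter>F'" using irredundant by simp
    moreover have "L \<subseteq> \<Inter>F'" using F' LN by auto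
    ultimately show "L \<subset> affine hull L \<inter> \<Inter>F'" using affL by auto
  qed
  let ?F = "\<lambda>h. L \<inter> {x. - real_vec (fst (row_of h)) \<bullet> x = - of_int (snd (row_of h))}"
  have face: "?F (hs n) = face n" if "n \<in> N" for n
    unfolding row_of[OF that] face_def by (cases n) auto
  have "{C. C facet_of L} = ?F ` (hs ` N)"
    unfolding facets by blast
  also have "\<dots> = face ` N"
    unfolding image_image by (intro image_cong refl face)
  finally have facets': "{C. C facet_of L} = face ` N" .
  have valid: "real_vec \<pi> \<bullet> x \<ge> of_int \<pi>0" if "(\<pi>, \<pi>0) \<in> N" "x \<in> L" for \<pi> \<pi>0 x
    using that LN by (auto simp: hs_def)
  have "inj_on face N"
  proof (rule inj_onI, clarify)
    fix \<pi> \<pi>0 \<rho> \<rho>0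
    assume mem: "(\<pi>, \<pi>0) \<in> N" "(\<rho>, \<rho>0) \<in> N" and eq: "face (\<pi>, \<pi>0) = face (\<rho>, \<rho>0)"
    have "face (\<pi>, \<pi>0) facet_of L" using facets' mem(1) by blast
    then obtain c where "c > 0" "real_vec \<rho> = c *\<^sub>R real_vec \<pi>" "of_int \<rho>0 = c * of_int \<pi>0"
      using facet_determines_row[OF int _ _ valid[OF mem(1)] valid[OF mem(2)]] eq prim mem
      by (auto simp: face_def)
    then have "\<pi> = \<rho> \<and> \<pi>0 = \<rho>0" using prim mem by (intro primitive_row_unique[of \<iota>]) auto
    then show "\<pi> = \<rho> \<and> \<pi>0 = \<rho>0" .
  qed
  then have "bij_betw face N {C. C facet_of L}" using facets' by (simp add: bij_betw_def)
  moreover have "L = {x. \<forall>(\<pi>, \<pi>0)\<in>N. real_vec \<pi> \<bullet> x \<ge> of_int \<pi>0}"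
    unfolding LN hs_def by auto
  ultimately have "facet_representation \<iota> L N"
    using prim unfolding facet_representation_def face_def primitive_row_def by fast
  then show ?thesis using that finN by blast
qed

section \<open>Split polyhedra of bounded facet width\<close>

text \<open>The midpoint of a strict solution of the earlier rows and a point strict for the new row
  is strict for all of them, since every row is weakly valid on \<open>S\<close>.\<close>

lemma common_strict_solution:
  fixes S :: "'a::euclidean_space set"
  assumes "finite G" "convex S" "S \<noteq> {}"
    and valid: "\<And>a b x. (a, b) \<in> G \<Longrightarrow> x \<in> S \<Longrightarrow> a \<bullet> x \<ge> b"
    and strict: "\<And>a b. (a, b) \<in> G \<Longrightarrow> \<exists>x\<in>S. a \<bullet> x > b"
  shows "\<exists>x\<in>S. \<forall>(a, b)\<in>G. a \<bullet> x > b"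
  using assms(1) valid strict
proof (induction G rule: finite_induct)
  case empty
  then show ?case using assms(3) by auto
next
  case (insert g G)
  obtain a b where g: "g = (a, b)" by (cases g)
  have "\<exists>x\<in>S. \<forall>(a, b)\<in>G. a \<bullet> x > b" by (rule insert.IH) (use insert.prems in auto)
  then obtain x where x: "x \<in> S" "\<And>a b. (a, b) \<in> G \<Longrightarrow> a \<bullet> x > b" by blast
  obtain y where y: "y \<in> S" "a \<bullet> y > b" using insert.prems(2)[of a b] g by blast
  define z where "z = (1/2) *\<^sub>R x + (1/2) *\<^sub>R y"
  have inner: "c \<bullet> z = (c \<bullet> x + c \<bullet> y) / 2" for c by (simp add: z_def inner_add_right)
  have "z \<in> S" unfolding z_def using x(1) y(1) by (intro convexD[OF assms(2)]) auto
  moreover have "c \<bullet> z > e" if ce: "(c, e) \<in> insert g G" for c e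
  proof (cases "(c, e) = (a, b)")
    case True
    then show ?thesis using y(2) insert.prems(1)[of a b x] x(1) g by (simp add: inner)
  next
    case False
    then have "(c, e) \<in> G" using ce g by blast
    then show ?thesis using x(2)[of c e] insert.prems(1)[of c e y] y(1) by (simp add: inner)
  qed
  ultimately show ?case by blast
qed

text \<open>If every row with nonzero normal were strict somewhere on \<open>S\<close>, a common
  strict solution would be an interior point; hence some row is tight on all of
  \<open>S\<close>.\<close>

lemma rational_polyhedron_in_hyperplane:
  fixes S :: "(real^'p::finite) set"
  assumes S: "rational_polyhedron S" and int: "interior S = {}"
  obtains a b where "a \<noteq> 0" "\<And>j. a $ j \<in> \<rat>" "S \<subseteq> {x. a \<bullet> x = b}"
proof -
  obtain F where F: "finite F" "\<forall>(a, b)\<in>F. (\<forall>j. a $ j \<in> \<rat>) \<and> b \<in> \<rat>"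
      "S = {x. \<forall>(a, b)\<in>F. a \<bullet> x \<ge> b}"
    using S unfolding rational_polyhedron_def by (elim exE conjE)
  define G where "G = {(a, b)\<in>F. a \<noteq> 0}"
  show ?thesis
  proof (cases "S = {}")
    case True
    show ?thesis by (rule that[of "\<chi> j. 1" 0]) (auto simp: True vec_eq_iff)
  next
    case False
    have SG: "S = {x. \<forall>(a, b)\<in>G. a \<bullet> x \<ge> b}"
      using False unfolding F(3) G_def by fastforce
    have finG: "finite G" unfolding G_def by (rule finite_subset[OF _ F(1)]) auto
    have "convex S" unfolding SG
    proof -
      have "{x. \<forall>(a, b)\<in>G. a \<bullet> x \<ge> b} = (\<Inter>(a, b)\<in>G. {x. a \<bullet> x \<ge> b})" by auto
      then show "convex {x. \<forall>(a, b)\<in>G. a \<bullet> x \<ge> b}"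
        by (auto intro!: convex_INT convex_halfspace_ge)
    qed
    have "interior S = {x. \<forall>(a, b)\<in>G. a \<bullet> x > b}"
      unfolding SG using finG by (intro interior_halfspaces) (auto simp: G_def)
    then have "\<not> (\<exists>x\<in>S. \<forall>(a, b)\<in>G. a \<bullet> x > b)" using int by blast
    then have "\<exists>(a, b)\<in>G. \<forall>x\<in>S. \<not> a \<bullet> x > b"
      using common_strict_solution[OF finG \<open>convex S\<close> False] SG by blast
    then obtain a b where ab: "(a, b) \<in> G" "\<And>x. x \<in> S \<Longrightarrow> a \<bullet> x \<le> b" by fastforce
    moreover have "a \<bullet> x \<ge> b" if "x \<in> S" for x using that ab(1) SG by blast
    ultimately have "S \<subseteq> {x. a \<bullet> x = b}" by (simp add: subset_iff order_antisym)
    then show ?thesis using ab(1) F(2) by (intro that[of a b]) (auto simp: G_def)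
  qed
qed

lemma inner_Ints:
  fixes a x :: "real^'n::finite"
  assumes "\<And>j. a $ j \<in> \<int>" "\<And>j. x $ j \<in> \<int>"
  shows "a \<bullet> x \<in> \<int>"
  unfolding inner_vec_def using assms by (auto intro!: Ints_sum Ints_mult)

text \<open>
  A rational polyhedron inside a hyperplane is properly contained in a lattice point free slab
  between two consecutive integer levels.
\<close>

lemma split_polyhedron_interior:
  fixes S :: "(real^'p::finite) set"
  assumes "split_polyhedron S"
  shows "interior S \<noteq> {}"
proof
  assume int: "interior S = {}"
  have "rational_polyhedron S" using assms by (simp add: split_polyhedron_def)
  then obtain a b where a: "a \<noteq> 0" "\<And>j. a $ j \<in> \<rat>" "S \<subseteq> {x. a \<bullet> x = b}"
    using rational_polyhedron_in_hyperplane int by blast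
  obtain D :: nat where D: "D > 0" "\<And>j. real D * a $ j \<in> \<int>"
    using finite_rats_common_denominator[of "range (\<lambda>j. a $ j)"] a(2) by auto
  define p where "p = real D *\<^sub>R a"
  have p: "p \<noteq> 0" "\<And>j. p $ j \<in> \<int>" using a D by (auto simp: p_def)
  \<comment> \<open>The level \<open>real D * b\<close> of \<open>S\<close> may or may not be an
    integer; the closed slab starting at its floor contains \<open>S\<close> either way.\<close>
  define k :: real where "k = of_int \<lfloor>real D * b\<rfloor>"
  have Sp: "p \<bullet> x = real D * b" if "x \<in> S" for x using that a(3) by (auto simp: p_def)
  define C where "C = {x. p \<bullet> x \<ge> k} \<inter> {x. p \<bullet> x \<le> k + 1}"
  have "S \<subseteq> C" using Sp unfolding C_def k_def by (auto intro: less_imp_le)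
  moreover have "convex C"
    unfolding C_def by (intro convex_Int convex_halfspace_ge convex_halfspace_le)
  moreover have "lattice_point_free C"
  proof -
    have intC: "interior C = {x. k < p \<bullet> x \<and> p \<bullet> x < k + 1}"
      unfolding C_def using p(1) by auto
    have "((k + 1/2) / (p \<bullet> p)) *\<^sub>R p \<in> interior C" unfolding intC using p(1) by simp
    then have "rel_interior C = interior C" by (intro rel_interior_nonempty_interior) blast
    moreover have "\<not> (k < p \<bullet> x \<and> p \<bullet> x < k + 1)" if x: "\<And>i. x $ i \<in> \<int>" for x
    proof
      assume lt: "k < p \<bullet> x \<and> p \<bullet> x < k + 1"
      obtain m where m: "p \<bullet> x = of_int m" using inner_Ints[OF p(2) x] by (auto elim: Ints_cases)
      have "\<lfloor>real D * b\<rfloor> < m" "m < \<lfloor>real D * b\<rfloor> + 1" using lt unfolding m k_def by linarith+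
      then show False by simp
    qed
    ultimately show ?thesis unfolding lattice_point_free_def intC by auto
  qed
  ultimately have "C = S" using assms unfolding split_polyhedron_def by blast
  \<comment> \<open>If the slab were \<open>S\<close>, all its levels, in particular
    \<open>k\<close> and \<open>k + 1\<close>, would equal the single level of
    \<open>S\<close>.\<close>
  have level: "t = real D * b" if "k \<le> t" "t \<le> k + 1" for t
  proof -
    have t: "p \<bullet> ((t / (p \<bullet> p)) *\<^sub>R p) = t" using p(1) by simp
    then have "(t / (p \<bullet> p)) *\<^sub>R p \<in> S" using that unfolding \<open>C = S\<close>[symmetric] C_def by simp
    then show ?thesis using Sp t by metis
  qed
  show False using level[of k] level[of "k + 1"] by simp
qed

text \<open>Rows of \<open>Lx\<close> pull back along \<open>proj\<close> through its adjoint
  \<open>lift\<close>. Since \<open>lift\<close> is also a section of the continuous map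
  \<open>proj\<close>, an interior point of \<open>Lx\<close> yields one of
  \<open>L\<close>.\<close>

lemma mixed_integer_split_rational:
  fixes \<iota> :: "'p::finite \<Rightarrow> 'n::finite" and L :: "(real^'n) set"
  assumes inj: "inj \<iota>" and L: "mixed_integer_split \<iota> L"
  obtains F where "finite F" "L = {x. \<forall>(a, b)\<in>F. a \<bullet> x \<ge> b}"
    "\<And>a b. (a, b) \<in> F \<Longrightarrow> (\<forall>j. a $ j \<in> \<rat>) \<and> b \<in> \<rat> \<and> (\<forall>j. j \<notin> range \<iota> \<longrightarrow> a $ j = 0)"
    "interior L \<noteq> {}"
proof -
  define proj :: "real^'n \<Rightarrow> real^'p" where "proj z = (\<chi> i. z $ \<iota> i)" for z
  define lift :: "real^'p \<Rightarrow> real^'n"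
    where "lift a = (\<chi> j. if j \<in> range \<iota> then a $ inv \<iota> j else 0)" for a
  obtain Lx :: "(real^'p) set" where Lx: "split_polyhedron Lx" "L = {z. proj z \<in> Lx}"
    using L unfolding mixed_integer_split_def proj_def by blast
  obtain F where F: "finite F" "\<forall>(a, b)\<in>F. (\<forall>j. a $ j \<in> \<rat>) \<and> b \<in> \<rat>"
      "Lx = {x. \<forall>(a, b)\<in>F. a \<bullet> x \<ge> b}"
    using Lx(1) unfolding split_polyhedron_def rational_polyhedron_def by (elim exE conjE)
  have lift: "lift a \<bullet> z = a \<bullet> proj z" for a z
  proof -
    have "lift a \<bullet> z = (\<Sum>j\<in>range \<iota>. a $ inv \<iota> j * z $ j)"
      unfolding inner_vec_def lift_def
      by (intro sum.mono_neutral_cong_right) auto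
    also have "\<dots> = a \<bullet> proj z"
      unfolding inner_vec_def proj_def sum.reindex[OF inj] by (simp add: inj)
    finally show ?thesis .
  qed
  have proj_lift: "proj (lift y) = y" for y
    by (simp add: proj_def lift_def vec_eq_iff inj)
  define F' where "F' = (\<lambda>(a, b). (lift a, b)) ` F"
  show ?thesis
  proof (rule that[of F'])
    show "finite F'" using F(1) by (simp add: F'_def)
    show "L = {x. \<forall>(a, b)\<in>F'. a \<bullet> x \<ge> b}"
      unfolding Lx(2) F(3) F'_def by (auto simp: lift)
    show "(\<forall>j. a $ j \<in> \<rat>) \<and> b \<in> \<rat> \<and> (\<forall>j. j \<notin> range \<iota> \<longrightarrow> a $ j = 0)" if "(a, b) \<in> F'" for a b
      using that F(2) by (auto simp: F'_def lift_def)
    have "linear proj" by (rule linearI) (auto simp: proj_def vec_eq_iff)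
    then have "continuous_on UNIV proj" by (intro linear_continuous_on) (simp add: linear_conv_bounded_linear)
    then have "open (proj -` interior Lx)" by (rule open_vimage[OF open_interior])
    then have "proj -` interior Lx \<subseteq> interior L"
      using interior_subset[of Lx] by (intro interior_maximal) (auto simp: Lx(2))
    moreover obtain y where "y \<in> interior Lx" using split_polyhedron_interior[OF Lx(1)] by blast
    moreover from this have "lift y \<in> proj -` interior Lx" by (simp add: proj_lift)
    ultimately show "interior L \<noteq> {}" by blast
  qed
qed

section \<open>Integral row systems with bounded slack\<close>

lemma width_ge:
  assumes "x \<in> L" "y \<in> L"
  shows "ereal (\<pi> \<bullet> x - \<pi> \<bullet> y) \<le> width L \<pi>"
proof -
  have "ereal (\<pi> \<bullet> x) - ereal (\<pi> \<bullet> y) \<le> width L \<pi>"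
    unfolding width_def using assms by (intro ereal_minus_mono SUP_upper INF_lower)
  then show ?thesis by simp
qed

text \<open>Collects what the final argument uses about a split. A facet row attains its right-hand
  side on the nonempty facet, so its slack anywhere in \<open>L\<close> is at most the width along
  its normal.\<close>

lemma mixed_integer_split_system:
  fixes \<iota> :: "'p::finite \<Rightarrow> 'n::finite" and L :: "(real^'n) set"
  assumes inj: "inj \<iota>" and L: "mixed_integer_split \<iota> L" and w: "max_facet_width \<iota> L \<le> ereal w"
  shows "\<exists>N. finite N \<and> (\<forall>(a, b)\<in>N. (\<forall>j. a $ j \<in> \<int>) \<and> b \<in> \<int>) \<and>
    interior L = strict_sols N \<and> (\<forall>(a, b)\<in>N. \<forall>x\<in>strict_sols N. a \<bullet> x - b \<le> w) \<and>
    strict_sols N \<noteq> {}"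
proof -
  obtain F where F: "finite F" "L = {x. \<forall>(a, b)\<in>F. a \<bullet> x \<ge> b}"
    "\<And>a b. (a, b) \<in> F \<Longrightarrow> (\<forall>j. a $ j \<in> \<rat>) \<and> b \<in> \<rat> \<and> (\<forall>j. j \<notin> range \<iota> \<longrightarrow> a $ j = 0)"
    "interior L \<noteq> {}"
    using mixed_integer_split_rational[OF inj L] by blast
  obtain M where M: "finite M" "facet_representation \<iota> L M"
    using facet_representation_exists[OF F(4,1,2,3)] by blast
  \<comment> \<open>Uniqueness of the normalised representation resolves the definite
    description.\<close>
  have "(THE N. facet_representation \<iota> L N) = M"
    using M(2) facet_representation_subset[OF F(4)] by (intro the_equality subset_antisym)
  then have mfw: "max_facet_width \<iota> L = Max ((\<lambda>(\<pi>, \<pi>0). width L (real_vec \<pi>)) ` M)"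
    by (simp add: max_facet_width_def)
  have slack: "real_vec \<pi> \<bullet> x - of_int \<pi>0 \<le> w" if mem: "(\<pi>, \<pi>0) \<in> M" and x: "x \<in> L" for \<pi> \<pi>0 x
  proof -
    have "L \<inter> {x. real_vec \<pi> \<bullet> x = of_int \<pi>0} \<noteq> {}"
      using facet_representation_rows(1)[OF M(2) mem] by (auto simp: facet_of_def)
    then obtain y where y: "y \<in> L" "real_vec \<pi> \<bullet> y = of_int \<pi>0" by blast
    have "ereal (real_vec \<pi> \<bullet> x - real_vec \<pi> \<bullet> y) \<le> width L (real_vec \<pi>)"
      using x y(1) by (rule width_ge)
    also have "\<dots> \<le> max_facet_width \<iota> L"
      unfolding mfw using M(1) mem by (intro Max_ge) force+
    also have "\<dots> \<le> ereal w" by (rule w)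
    finally show ?thesis using y(2) by simp
  qed
  define N where "N = (\<lambda>(\<pi>, \<pi>0). (real_vec \<pi>, real_of_int \<pi>0)) ` M"
  have finN: "finite N" using M(1) by (simp add: N_def)
  have "L = {x. \<forall>(\<pi>, \<pi>0)\<in>M. real_vec \<pi> \<bullet> x \<ge> of_int \<pi>0}"
    using M(2) unfolding facet_representation_def by blast
  then have LN: "L = {x. \<forall>(a, b)\<in>N. a \<bullet> x \<ge> b}" unfolding N_def by auto
  have intL: "interior L = strict_sols N"
    unfolding LN strict_sols_def using finN facet_representation_rows(4)[OF M(2)]
    by (intro interior_halfspaces) (auto simp: N_def)
  show ?thesis
  proof (intro exI[of _ N] conjI finN intL)
    show "\<forall>(a, b)\<in>N. (\<forall>j. a $ j \<in> \<int>) \<and> b \<in> \<int>"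
      by (auto simp: N_def)
    have "a \<bullet> x - b \<le> w" if "(a, b) \<in> N" "x \<in> strict_sols N" for a b x
      using that slack intL interior_subset[of L] by (auto simp: N_def)
    then show "\<forall>(a, b)\<in>N. \<forall>x\<in>strict_sols N. a \<bullet> x - b \<le> w" by blast
    show "strict_sols N \<noteq> {}" using F(4) intL by simp
  qed
qed

text \<open>A row increasing along a recession direction would have unbounded slack. This supplies
  the hypothesis \<open>rec\<close> of the hull lemmas.\<close>

lemma bounded_slack_recession:
  assumes slack: "\<And>a b x. (a, b) \<in> N \<Longrightarrow> x \<in> strict_sols N \<Longrightarrow> a \<bullet> x - b \<le> w"
    and ne: "strict_sols N \<noteq> {}" and d: "\<forall>(a, b)\<in>N. a \<bullet> d \<ge> 0"
  shows "\<forall>(a, b)\<in>N. a \<bullet> d = 0"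
proof clarify
  fix a b assume ab: "(a, b) \<in> N"
  obtain x where x: "x \<in> strict_sols N" using ne by blast
  show "a \<bullet> d = 0"
  proof (rule ccontr)
    assume "a \<bullet> d \<noteq> 0"
    then have pos: "a \<bullet> d > 0" using d ab by force
    have ax: "a \<bullet> x > b" using x ab by (auto simp: strict_sols_def)
    \<comment> \<open>After time \<open>t\<close> the slack has grown by \<open>w\<close> from a
      positive value, so it exceeds \<open>w\<close>.\<close>
    define t where "t = w / (a \<bullet> d)"
    have "w \<ge> 0" using slack[OF ab x] ax by simp
    then have t: "t \<ge> 0" using pos by (simp add: t_def)
    have "c \<bullet> (x + t *\<^sub>R d) > e" if ce: "(c, e) \<in> N" for c e
    proof -
      have "c \<bullet> x > e" using x ce by (auto simp: strict_sols_def)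
      moreover have "t * (c \<bullet> d) \<ge> 0" using d ce t by (intro mult_nonneg_nonneg) auto
      ultimately show ?thesis by (simp add: inner_add_right)
    qed
    then have "x + t *\<^sub>R d \<in> strict_sols N" by (auto simp: strict_sols_def)
    from slack[OF ab this] have "a \<bullet> x + w - b \<le> w" using pos by (simp add: inner_add_right t_def)
    then show False using ax by simp
  qed
qed

text \<open>
  The slack \<open>D (a \<bullet> v - b)\<close> is a positive integer of size at most \<open>D w\<close>, so all denominators
  of the exit rates divide one factorial.
\<close>

lemma exit_rate_integral:
  fixes N :: "((real^'n::finite) \<times> real) set"
  assumes fin: "finite N" and rows: "\<And>a b. (a, b) \<in> N \<Longrightarrow> (\<forall>j. a $ j \<in> \<int>) \<and> b \<in> \<int>"
    and v: "v \<in> strict_sols N" and slack: "\<And>a b. (a, b) \<in> N \<Longrightarrow> a \<bullet> v - b \<le> w"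
    and D: "D > 0" and Dv: "\<And>j. real D * v $ j \<in> \<int>" and Dd: "\<And>j. real D * d $ j \<in> \<int>"
  shows "fact (nat \<lceil>real D * w\<rceil>) * exit_rate N v d \<in> \<int>"
proof (cases rule: exit_rate_cases[OF fin, of v d])
  case (2 a b)
  note ab = 2(1)
  have "a \<bullet> (real D *\<^sub>R v) \<in> \<int>"
    by (rule inner_Ints) (use rows[OF ab] Dv in auto)
  moreover have "a \<bullet> (real D *\<^sub>R d) \<in> \<int>"
    by (rule inner_Ints) (use rows[OF ab] Dd in auto)
  moreover have "real D * b \<in> \<int>" using rows[OF ab] by simp
  ultimately have "real D * (a \<bullet> v) - real D * b \<in> \<int>" "real D * (a \<bullet> d) \<in> \<int>"
    by (simp_all add: Ints_diff)
  \<comment> \<open>\<open>k\<close> and \<open>l\<close> are \<open>D\<close> times the slack at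
    \<open>v\<close> and \<open>D\<close> times the slope along \<open>d\<close>; the factor
    \<open>D\<close> cancels in the rate.\<close>
  then obtain k l where k: "real D * (a \<bullet> v) - real D * b = of_int k" and l: "real D * (a \<bullet> d) = of_int l"
    by (meson Ints_cases)
  have k': "real_of_int k = real D * (a \<bullet> v - b)" using k by (simp add: algebra_simps)
  have "a \<bullet> v - b > 0" using v ab by (auto simp: strict_sols_def)
  then have "real_of_int k > 0" unfolding k' using D by simp
  then have kpos: "k > 0" by simp
  have "real_of_int k \<le> real D * w" unfolding k' using slack[OF ab] by (intro mult_left_mono) auto
  then have "k \<le> \<lceil>real D * w\<rceil>" by linarith
  then have "nat k \<le> nat \<lceil>real D * w\<rceil>" by simp
  then have "nat k dvd fact (nat \<lceil>real D * w\<rceil>)" using kpos by (intro dvd_fact) auto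
  then obtain q where q: "fact (nat \<lceil>real D * w\<rceil>) = nat k * q" by (auto elim: dvdE)
  have "(fact (nat \<lceil>real D * w\<rceil>) :: real) = of_nat (fact (nat \<lceil>real D * w\<rceil>))"
    by (rule of_nat_fact[symmetric])
  also have "\<dots> = of_int k * of_nat q" unfolding q using kpos by simp
  finally have f: "(fact (nat \<lceil>real D * w\<rceil>) :: real) = of_int k * of_nat q" .
  have "exit_rate N v d = - (real D * (a \<bullet> d)) / (real D * (a \<bullet> v - b))"
    unfolding 2(2) using D by simp
  also have "\<dots> = - of_int l / of_int k" using l k' by simp
  finally have "fact (nat \<lceil>real D * w\<rceil>) * exit_rate N v d = of_int (- l * int q)"
    unfolding f using kpos by simp
  then show ?thesis by (metis Ints_of_int)
qed simp

section \<open>Reduction of the family to finitely many members\<close>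

theorem theorem4p2:
  fixes \<iota> :: "'p::finite \<Rightarrow> 'n::finite"
    and P :: "(real^'n) set"
    and V :: "'i set" and v :: "'i \<Rightarrow> real^'n"
    and E :: "'j set" and r :: "'j \<Rightarrow> real^'n"
    and w :: real
    and \<L> :: "(real^'n) set set"
  assumes "inj \<iota>"
    and "rational_polyhedron P"
    and "finite V" and "finite E"
    and "\<And>i k. i \<in> V \<Longrightarrow> v i $ k \<in> \<rat>"
    and "\<And>j k. j \<in> E \<Longrightarrow> r j $ k \<in> \<int>"
    and "v ` V = {x. x extreme_point_of P}"
    and "\<And>j. j \<in> E \<Longrightarrow> extreme_ray_of (r j) P"
    and "P = {x + y | x y. x \<in> convex hull (v ` V) \<and> y \<in> convex_cone hull (r ` E)}"
    and "w > 0"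
    and "\<And>L. L \<in> \<L> \<Longrightarrow> mixed_integer_split \<iota> L"
    and "\<And>L. L \<in> \<L> \<Longrightarrow> max_facet_width \<iota> L \<le> ereal w"
  shows "polyhedron (\<Inter>L\<in>\<L>. R L P)"
proof -
  define W where "W = v ` V"
  define T where "T = r ` E"
  have fin: "finite W" "finite T" using assms(3,4) by (simp_all add: W_def T_def)
  have P: "P = conv_cone W T" unfolding assms(9) conv_cone_def W_def T_def ..
  define sys where "sys L N \<longleftrightarrow> finite N \<and> (\<forall>(a, b)\<in>N. (\<forall>j. a $ j \<in> \<int>) \<and> b \<in> \<int>) \<and>
      interior L = strict_sols N \<and> (\<forall>(a, b)\<in>N. \<forall>x\<in>strict_sols N. a \<bullet> x - b \<le> w) \<and>
      strict_sols N \<noteq> {}" for L and N :: "((real^'n) \<times> real) set"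
  \<comment> \<open>From here on a member of the family enters only through its row system.\<close>
  have "\<exists>N. sys L N" if L: "L \<in> \<L>" for L
    unfolding sys_def
    by (rule mixed_integer_split_system[OF assms(1) assms(11)[OF L] assms(12)[OF L]])
  then obtain rows where "\<And>L. L \<in> \<L> \<Longrightarrow> sys L (rows L)" by metis
  then have finN: "finite (rows L)" and ints: "(a, b) \<in> rows L \<Longrightarrow> (\<forall>j. a $ j \<in> \<int>) \<and> b \<in> \<int>"
    and intL: "interior L = strict_sols (rows L)"
    and slack: "(a, b) \<in> rows L \<Longrightarrow> x \<in> strict_sols (rows L) \<Longrightarrow> a \<bullet> x - b \<le> w"
    and ne: "strict_sols (rows L) \<noteq> {}" if "L \<in> \<L>" for L a b x
    using that unfolding sys_def by blast+
  have RL: "R L P = convex hull (conv_cone W T - strict_sols (rows L))" if "L \<in> \<L>" for L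
    unfolding R_def intL[OF that] P by (simp add: set_diff_eq)
  have rec: "\<forall>(a, b)\<in>rows L. a \<bullet> d = 0" if "L \<in> \<L>" "\<forall>(a, b)\<in>rows L. a \<bullet> d \<ge> 0" for L d
    using slack[OF that(1)] ne[OF that(1)] that(2) by (rule bounded_slack_recession)
  have poly: "polyhedron (R L P)" if L: "L \<in> \<L>" for L
  proof -
    have "R L P = conv_cone (exit_points (rows L) W T) T"
      unfolding RL[OF L] using finN[OF L] fin rec[OF L] by (rule hull_minus_strict_sols_eq)
    then show ?thesis using polyhedron_conv_cone[OF finite_exit_points[OF fin] fin(2)] by simp
  qed
  have X: "(\<Union>u\<in>W. range (\<lambda>j. u $ j)) \<subseteq> \<rat>" using assms(5) by (auto simp: W_def)
  have "finite (\<Union>u\<in>W. range (\<lambda>j. u $ j))" using fin(1) by simp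
  \<comment> \<open>\<open>D\<close> clears all vertices, hence their differences; the rays are
    integral, so it clears every direction used below.\<close>
  from finite_rats_common_denominator[OF this X] obtain D :: nat where D: "D > 0"
      "\<forall>x\<in>(\<Union>u\<in>W. range (\<lambda>j. u $ j)). real D * x \<in> \<int>" by (elim exE conjE)
  have DW: "real D * u $ j \<in> \<int>" if "u \<in> W" for u j using D(2) that by blast
  \<comment> \<open>\<open>M\<close> depends only on \<open>D\<close> and \<open>w\<close>, so it
    clears the exit rates of all members at once.\<close>
  define M :: nat where "M = fact (nat \<lceil>real D * w\<rceil>)"
  have M: "M > 0" by (simp add: M_def)
  \<comment> \<open>Directions lead to all vertices, inner or outer, so that the index set is the
    same for every member.\<close>
  define K where "K = (SIGMA u:W. T \<union> (\<lambda>u'. u' - u) ` W)"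
  have finK: "finite K" unfolding K_def using fin by auto
  \<comment> \<open>For a vertex inside the member, rounding changes nothing because the scaled rate
    is a nonnegative integer. For other vertices the value is merely an extra coordinate in the
    comparison.\<close>
  define key where "key L = (\<lambda>(u, d). nat \<lfloor>real M * exit_rate (rows L) u d\<rfloor>)" for L
  have key: "real (key L (u, d)) = real M * exit_rate (rows L) u d"
    if L: "L \<in> \<L>" and u: "u \<in> W" "u \<in> strict_sols (rows L)" and d: "d \<in> T \<union> (\<lambda>u'. u' - u) ` W"
    for L u d
  proof -
    have Dd: "real D * d $ j \<in> \<int>" for j
    proof (cases "d \<in> T")
      case True
      then show ?thesis using assms(6) by (auto simp: T_def)
    next
      case False
      then obtain u' where "u' \<in> W" "d = u' - u" using d by blast
      then show ?thesis using DW u(1) by (simp add: right_diff_distrib)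
    qed
    have "real M * exit_rate (rows L) u d \<in> \<int>"
      unfolding M_def of_nat_fact
      using finN[OF L] ints[OF L] u(2) slack[OF L _ u(2)] D(1) DW[OF u(1)] Dd
      by (rule exit_rate_integral)
    then obtain k where k: "real M * exit_rate (rows L) u d = of_int k" by (auto elim: Ints_cases)
    have "real M * exit_rate (rows L) u d \<ge> 0" using exit_rate_nonneg[OF finN[OF L]] by simp
    then show ?thesis unfolding key_def by (simp add: k)
  qed
  have mono: "R L P \<subseteq> R L' P"
    if L: "L \<in> \<L>" "L' \<in> \<L>" and same: "W \<inter> strict_sols (rows L) = W \<inter> strict_sols (rows L')"
      and le: "\<forall>k\<in>K. key L k \<le> key L' k" for L L'
    unfolding RL[OF L(1)] RL[OF L(2)]
  proof (rule hull_minus_strict_sols_mono[OF finN[OF L(1)] finN[OF L(2)] fin rec[OF L(1)] rec[OF L(2)] same])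
    fix u d assume u: "u \<in> W \<inter> strict_sols (rows L)" and d: "d \<in> T \<union> (\<lambda>u'. u' - u) ` W"
    have "(u, d) \<in> K" using u d unfolding K_def by blast
    then have "real (key L (u, d)) \<le> real (key L' (u, d))" using le by simp
    moreover have "u \<in> strict_sols (rows L')" using u same by blast
    ultimately have "real M * exit_rate (rows L) u d \<le> real M * exit_rate (rows L') u d"
      using key[OF L(1) _ _ d] key[OF L(2) _ _ d] u by simp
    then show "exit_rate (rows L) u d \<le> exit_rate (rows L') u d" using M by simp
  qed
  \<comment> \<open>The monotonicity result compares members with the same vertices inside; there
    are only finitely many such classes.\<close>
  define fam where "fam U = {L\<in>\<L>. W \<inter> strict_sols (rows L) = U}" for U
  define basis where "basis U B \<longleftrightarrow> B \<subseteq> fam U \<and> finite B \<and>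
      (\<forall>L\<in>fam U. \<exists>L'\<in>B. \<forall>k\<in>K. key L' k \<le> key L k)" for U B
  have "\<exists>B. basis U B" for U
    unfolding basis_def by (rule dickson_finite_basis[OF finK])
  then obtain B where "\<And>U. basis U (B U)" by metis
  then have B: "\<And>U. B U \<subseteq> fam U" "\<And>U. finite (B U)"
      "\<And>U L. L \<in> fam U \<Longrightarrow> \<exists>L'\<in>B U. \<forall>k\<in>K. key L' k \<le> key L k"
    unfolding basis_def by simp_all
  define \<B> where "\<B> = (\<Union>U\<in>Pow W. B U)"
  have sub: "\<B> \<subseteq> \<L>" using B(1) unfolding \<B>_def fam_def by blast
  have "\<exists>L'\<in>\<B>. R L' P \<subseteq> R L P" if L: "L \<in> \<L>" for L
  proof -
    define U where "U = W \<inter> strict_sols (rows L)"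
    have "L \<in> fam U" using L by (simp add: fam_def U_def)
    then obtain L' where L': "L' \<in> B U" "\<forall>k\<in>K. key L' k \<le> key L k" using B(3) by blast
    then have "L' \<in> fam U" using B(1) by blast
    then have "R L' P \<subseteq> R L P" using L L'(2) by (intro mono) (auto simp: fam_def U_def)
    moreover have "L' \<in> \<B>" using L'(1) unfolding \<B>_def U_def by blast
    ultimately show ?thesis by blast
  qed
  then have "(\<Inter>L\<in>\<L>. R L P) = (\<Inter>L\<in>\<B>. R L P)" using sub by blast
  moreover have "finite \<B>" unfolding \<B>_def using fin(1) B(2) by blast
  ultimately show ?thesis using poly sub by (auto intro!: polyhedron_Inter)
qed

end
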